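(* Let $G=(V,E)$ be a finite simple undirected graph with edge weights $w\in\mathbb{R}^E_{\ge 0}$, let $\hat x$ be a basic maximum-weight fractional matching of $G$ and let $y$ be a minimum fractional $w$-vertex cover of $G$. If $|\mathscr{C}(\hat x)|>\gamma(G)$, then there exists (i) a vertex $v\in V(C_i)$ for some odd cycle $C_i\in\mathscr{C}(\hat x)$ such that $y_v=0$; or (ii) a tight $M(\hat x)$-alternating path $P$ which connects two odd cycles $C_i,C_j\in\mathscr{C}(\hat x)$; or (iii) a tight and valid $M(\hat x)$-alternating path $P$ which connects an odd cycle $C_i\in\mathscr{C}(\hat x)$ and a vertex $v\notin V(\mathscr{C}(\hat x))$ such that $y_v=0$. Furthermore, alternate rounding on the odd cycle(s) involved (at the vertex $v$ in case (i), at the endpoints of $P$ lying on them in cases (ii),(iii)) and complementing on the path produces a basic maximum-weight fractional matching $\bar x$ such that $\mathscr{C}(\bar x)\subsetneq \mathscr{C}(\hat x)$.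
   Context: A fractional matching is $x\in\mathbb{R}^E$, $x\ge0$, $x(\delta(v))\le 1$ for all $v$ ($\delta(v)$ = edges incident to $v$); it is basic if it is a vertex of this polytope and maximum-weight if it maximizes $w^\top x$. A fractional $w$-vertex cover is $y\in\mathbb{R}^V_{\ge0}$ with $y_u+y_v\ge w_{uv}$ for all $uv\in E$; it is minimum if it minimizes $\sum_v y_v$. An edge $uv$ is tight (w.r.t. $y$) if $y_u+y_v=w_{uv}$; a path is tight if all its edges are. A basic fractional matching $x$ has entries in $\{0,\frac12,1\}$ and its $\frac12$-edges form vertex-disjoint odd cycles; $\mathscr{C}(x)$ is this set of odd cycles, $V(\mathscr{C}(x))$ their vertex set, and $M(x)=\{e: x_e=1\}$. $\gamma(G)$ is the minimum of $|\mathscr{C}(x)|$ over basic maximum-weight fractional matchings $x$. For a matching $M$, a path is $M$-alternating if its edges alternately belong to $M$ and $E\setminus M$; it is valid if it starts with an $M$-exposed vertex or an edge of $M$, and ends with an $M$-exposed vertex or an edge of $M$. Complementing on $E'\subseteq E$ replaces $x_e$ by $1-x_e$ for $e\in E'$. Alternate rounding on $C=(e_1,\dots,e_{2k+1})\in\mathscr{C}(x)$ at $v=e_1\cap e_{2k+1}$ sets $x_e=0$ for $e\in\{e_1,e_3,\dots,e_{2k+1}\}$ and $x_e=1$ for $e\in\{e_2,e_4,\dots,e_{2k}\}$. *)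

theory Defs
  imports "HOL-Analysis.Analysis"
begin

text \<open>The vertex set is the finite type \<open>'v\<close>; a graph is its set of edges.\<close>

definition simple_graph :: "'v::finite set set \<Rightarrow> bool" where
  "simple_graph E \<longleftrightarrow> (\<forall>e\<in>E. card e = 2)"

definition incident :: "'v::finite set set \<Rightarrow> 'v \<Rightarrow> 'v set set" where
  "incident E v = {e \<in> E. v \<in> e}"

definition path_edges :: "'v list \<Rightarrow> 'v set list" where
  "path_edges p = map2 (\<lambda>u v. {u, v}) p (tl p)"

definition is_path :: "'v::finite set set \<Rightarrow> 'v list \<Rightarrow> bool" where
  "is_path E p \<longleftrightarrow> p \<noteq> [] \<and> distinct p \<and> set (path_edges p) \<subseteq> E"

definition cycle_edges :: "'v list \<Rightarrow> 'v set list" where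
  "cycle_edges c = path_edges (c @ [hd c])"

definition is_cycle :: "'v::finite set set \<Rightarrow> 'v list \<Rightarrow> bool" where
  "is_cycle E c \<longleftrightarrow> 3 \<le> length c \<and> distinct c \<and> set (cycle_edges c) \<subseteq> E"

text \<open>The space of real vectors indexed by \<open>E\<close> is the coordinate subspace of
  \<^typ>\<open>real^('v set)\<close> of vectors that vanish outside \<open>E\<close>.\<close>

definition fractional_matchings :: "'v::finite set set \<Rightarrow> (real^('v set)) set" where
  "fractional_matchings E =
     {x. (\<forall>e. e \<notin> E \<longrightarrow> x $ e = 0) \<and> (\<forall>e\<in>E. 0 \<le> x $ e) \<and>
         (\<forall>v. (\<Sum>e\<in>incident E v. x $ e) \<le> 1)}"

definition max_weight_fm ::
    "'v::finite set set \<Rightarrow> ('v set \<Rightarrow> real) \<Rightarrow> real^('v set) \<Rightarrow> bool" where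
  "max_weight_fm E w x \<longleftrightarrow> x \<in> fractional_matchings E \<and>
     (\<forall>z\<in>fractional_matchings E. (\<Sum>e\<in>E. w e * z $ e) \<le> (\<Sum>e\<in>E. w e * x $ e))"

definition basic_max_weight_fm ::
    "'v::finite set set \<Rightarrow> ('v set \<Rightarrow> real) \<Rightarrow> real^('v set) \<Rightarrow> bool" where
  "basic_max_weight_fm E w x \<longleftrightarrow>
     x extreme_point_of fractional_matchings E \<and> max_weight_fm E w x"

definition fractional_covers ::
    "'v::finite set set \<Rightarrow> ('v set \<Rightarrow> real) \<Rightarrow> (real^'v) set" where
  "fractional_covers E w =
     {y. (\<forall>v. 0 \<le> y $ v) \<and> (\<forall>u v. {u, v} \<in> E \<longrightarrow> w {u, v} \<le> y $ u + y $ v)}"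

definition min_fractional_cover ::
    "'v::finite set set \<Rightarrow> ('v set \<Rightarrow> real) \<Rightarrow> real^'v \<Rightarrow> bool" where
  "min_fractional_cover E w y \<longleftrightarrow> y \<in> fractional_covers E w \<and>
     (\<forall>z\<in>fractional_covers E w. (\<Sum>v\<in>UNIV. y $ v) \<le> (\<Sum>v\<in>UNIV. z $ v))"

text \<open>A cycle is identified with its set of edges. For basic \<open>x\<close> the edges of value one half
  form vertex-disjoint odd cycles, and these are then the only cycles made up of such edges.\<close>

definition half_cycles :: "'v::finite set set \<Rightarrow> real^('v set) \<Rightarrow> 'v set set set" where
  "half_cycles E x =
     {set (cycle_edges c) | c. is_cycle E c \<and> odd (length c) \<and>
                               (\<forall>e\<in>set (cycle_edges c). x $ e = 1/2)}"

definition unit_edges :: "'v::finite set set \<Rightarrow> real^('v set) \<Rightarrow> 'v set set" where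
  "unit_edges E x = {e \<in> E. x $ e = 1}"

definition gamma :: "'v::finite set set \<Rightarrow> ('v set \<Rightarrow> real) \<Rightarrow> nat" where
  "gamma E w = Min {card (half_cycles E x) | x. basic_max_weight_fm E w x}"

definition tight_path :: "('v::finite set \<Rightarrow> real) \<Rightarrow> real^'v \<Rightarrow> 'v list \<Rightarrow> bool" where
  "tight_path w y p \<longleftrightarrow> (\<forall>u v. {u, v} \<in> set (path_edges p) \<longrightarrow> y $ u + y $ v = w {u, v})"

definition alternating :: "'v set set \<Rightarrow> 'v list \<Rightarrow> bool" where
  "alternating M p \<longleftrightarrow> (\<forall>i. Suc i < length (path_edges p) \<longrightarrow>
     (path_edges p ! i \<in> M \<longleftrightarrow> path_edges p ! Suc i \<notin> M))"

definition exposed :: "'v set set \<Rightarrow> 'v \<Rightarrow> bool" where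
  "exposed M v \<longleftrightarrow> (\<forall>e\<in>M. v \<notin> e)"

definition valid_alt_path :: "'v set set \<Rightarrow> 'v list \<Rightarrow> bool" where
  "valid_alt_path M p \<longleftrightarrow> alternating M p \<and>
     (exposed M (hd p) \<or> path_edges p \<noteq> [] \<and> hd (path_edges p) \<in> M) \<and>
     (exposed M (last p) \<or> path_edges p \<noteq> [] \<and> last (path_edges p) \<in> M)"

definition complement_on :: "'v::finite set set \<Rightarrow> real^('v set) \<Rightarrow> real^('v set)" where
  "complement_on F x = (\<chi> e. if e \<in> F then 1 - x $ e else x $ e)"

text \<open>The vertices of the cycle \<open>C\<close> in cyclic order, starting at \<open>v\<close>. The order is unique up to
  its direction, and \<open>alternate_round\<close> does not depend on the direction because \<open>C\<close> is odd.\<close>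

definition traversal :: "'v::finite set set \<Rightarrow> 'v \<Rightarrow> 'v list" where
  "traversal C v = (SOME c. is_cycle C c \<and> hd c = v \<and> set (cycle_edges c) = C)"

text \<open>Positions in \<open>cycle_edges\<close> are counted from 0, so the even ones carry
  \<open>e\<^sub>1, e\<^sub>3, \<dots>\<close>.\<close>

definition alternate_round ::
    "'v::finite set set \<Rightarrow> 'v \<Rightarrow> real^('v set) \<Rightarrow> real^('v set)" where
  "alternate_round C v x =
     (let es = cycle_edges (traversal C v) in
      \<chi> e. if \<exists>i<length es. even i \<and> e = es ! i then 0
           else if \<exists>i<length es. odd i \<and> e = es ! i then 1
           else x $ e)"

lemma cycle_edges_rotate1: "set (cycle_edges (rotate1 c)) = set (cycle_edges c)"
proof (cases c)
  case (Cons a c')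
  then show ?thesis
  proof (cases c')
    case (Cons b d)
    have snoc: "path_edges (xs @ [u, v]) = path_edges (xs @ [u]) @ [{u, v}]"
      for xs :: "'a list" and u v
      by (induction xs rule: induct_list012) (auto simp: path_edges_def)
    show ?thesis
      using snoc[of "b # d" a b] \<open>c = a # c'\<close> Cons
      by (auto simp: cycle_edges_def path_edges_def)
  qed (simp add: cycle_edges_def)
qed simp

lemma cycle_edges_rotate: "set (cycle_edges (rotate n c)) = set (cycle_edges c)"
  by (induction n) (simp_all add: cycle_edges_rotate1)

lemma Union_path_edges: "\<Union> (set (path_edges p)) \<subseteq> set p"
  by (cases p) (auto simp: path_edges_def dest: set_zip_leftD set_zip_rightD)

lemma traversal_ex:
  assumes "C \<in> half_cycles E x" "v \<in> \<Union> C"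
  shows "\<exists>c. is_cycle C c \<and> hd c = v \<and> set (cycle_edges c) = C"
proof -
  obtain c where c: "is_cycle E c" "C = set (cycle_edges c)"
    using assms(1) by (auto simp: half_cycles_def)
  then have ne: "c \<noteq> []" by (auto simp: is_cycle_def)
  have "v \<in> set c"
    using assms(2) c(2) Union_path_edges[of "c @ [hd c]"] ne by (auto simp: cycle_edges_def)
  then obtain i where i: "i < length c" "c ! i = v" by (auto simp: in_set_conv_nth)
  have "hd (rotate i c) = v" using i ne by (simp add: hd_rotate_conv_nth)
  then show ?thesis
    using c by (intro exI[of _ "rotate i c"]) (simp add: is_cycle_def cycle_edges_rotate)
qed

definition config_vertex ::
    "'v::finite set set \<Rightarrow> real^('v set) \<Rightarrow> real^'v \<Rightarrow> 'v set set \<Rightarrow> 'v \<Rightarrow> bool" where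
  "config_vertex E x y C v \<longleftrightarrow> C \<in> half_cycles E x \<and> v \<in> \<Union> C \<and> y $ v = 0"

definition config_cycle_cycle ::
    "'v::finite set set \<Rightarrow> ('v set \<Rightarrow> real) \<Rightarrow> real^('v set) \<Rightarrow> real^'v \<Rightarrow>
     'v set set \<Rightarrow> 'v set set \<Rightarrow> 'v list \<Rightarrow> bool" where
  "config_cycle_cycle E w x y C D p \<longleftrightarrow>
     C \<in> half_cycles E x \<and> D \<in> half_cycles E x \<and> C \<noteq> D \<and>
     is_path E p \<and> hd p \<in> \<Union> C \<and> last p \<in> \<Union> D \<and>
     tight_path w y p \<and> alternating (unit_edges E x) p"

definition config_cycle_vertex ::
    "'v::finite set set \<Rightarrow> ('v set \<Rightarrow> real) \<Rightarrow> real^('v set) \<Rightarrow> real^'v \<Rightarrow>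
     'v set set \<Rightarrow> 'v list \<Rightarrow> bool" where
  "config_cycle_vertex E w x y C p \<longleftrightarrow>
     C \<in> half_cycles E x \<and>
     is_path E p \<and> hd p \<in> \<Union> C \<and> last p \<notin> \<Union> (\<Union> (half_cycles E x)) \<and> y $ last p = 0 \<and>
     tight_path w y p \<and> valid_alt_path (unit_edges E x) p"

end

theory Submission
  imports Defs
begin

text \<open>By LP duality, a fractional matching is optimal iff it satisfies complementary slackness with
  \<open>y\<close>, and a fractional matching is basic iff its fractional edges have value one half and lie on
  odd cycles of such edges. Rounding and complementing preserve both properties, since only tight
  edges are used and only vertices with \<open>y\<^sub>v = 0\<close> can become exposed.

  For existence, let \<open>z\<close> be a basic optimal solution with fewer odd cycles. Rounding all odd cycles of
  \<open>x\<close> and of \<open>z\<close> yields two matchings that consist of tight edges. In their symmetric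
  difference, follow the path starting at the exposed vertex of each cycle of \<open>x\<close>. There are more
  such paths than odd cycles of \<open>z\<close>, so one of them ends in another exposed vertex of a cycle of
  \<open>x\<close> or in a vertex with \<open>y\<^sub>v = 0\<close>; a segment of it that avoids the odd cycles except at
  its ends is the required path.\<close>

subsection \<open>Complementary slackness\<close>

text \<open>The walk alternates between the two rounded matchings, but the required path must
  alternate with respect to \<open>unit_edges E x\<close>. The two notions agree only on edges
  outside the odd cycles of \<open>x\<close>, and a walk may run through such cycles several times;
  this is why a segment between visits has to be cut out.

  The counting is forced by the rounding of \<open>z\<close>: a vertex at which one of its cycles
  was rounded becomes exposed although nothing is known about its \<open>y\<close>-value. Every
  other exposed vertex is either exposed in \<open>x\<close> or \<open>z\<close> itself, where
  slackness gives \<open>y\<close> the value 0, or is a rounding vertex of \<open>x\<close>. The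
  vertices at which the cycles are rounded can be chosen arbitrarily.

  A dual solution that attains the primal optimum comes from separating the attainable pairs of
  capacity vector and weight from the pairs with unit capacities and a weight above the optimum.
  Matchings enter the walk as involutions on the vertices, so the components of the symmetric
  difference never have to be built as graphs.\<close>

definition load :: "'v::finite set set \<Rightarrow> real^('v set) \<Rightarrow> 'v \<Rightarrow> real" where
  "load E x v = (\<Sum>e\<in>incident E v. x $ e)"

lemma load_add: "load E (x + z) v = load E x v + load E z v"
  by (simp add: load_def sum.distrib)

lemma load_scaleR: "load E (c *\<^sub>R x) v = c * load E x v"
  by (simp add: load_def sum_distrib_left)

text \<open>Double counting of incident pairs: both sides are the bilinear form of the vertex-edge
  incidence matrix.\<close>

lemma sum_load:
  fixes y :: "real^'v::finite"
  shows "(\<Sum>v\<in>UNIV. y $ v * load E x v) = (\<Sum>e\<in>E. (\<Sum>v\<in>e. y $ v) * x $ e)"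
proof -
  have "(\<Sum>v\<in>UNIV. y $ v * load E x v) = (\<Sum>v\<in>UNIV. \<Sum>e | e \<in> E \<and> v \<in> e. y $ v * x $ e)"
    by (simp add: load_def incident_def sum_distrib_left)
  also have "\<dots> = (\<Sum>e\<in>E. \<Sum>v | v \<in> UNIV \<and> v \<in> e. y $ v * x $ e)"
    by (rule sum.swap_restrict) auto
  finally show ?thesis by (simp add: sum_distrib_right)
qed

lemma fm_iff:
  "x \<in> fractional_matchings E \<longleftrightarrow>
     (\<forall>e. e \<notin> E \<longrightarrow> x $ e = 0) \<and> (\<forall>e\<in>E. 0 \<le> x $ e) \<and> (\<forall>v. load E x v \<le> 1)"
  by (simp add: fractional_matchings_def load_def)

lemma fm_nonneg: "x \<in> fractional_matchings E \<Longrightarrow> 0 \<le> x $ e"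
  by (cases "e \<in> E") (auto simp: fm_iff)

lemma sum_le_load:
  assumes "x \<in> fractional_matchings E" "A \<subseteq> E" "\<And>e. e \<in> A \<Longrightarrow> v \<in> e"
  shows "(\<Sum>e\<in>A. x $ e) \<le> load E x v"
  unfolding load_def using assms
  by (intro sum_mono2) (auto simp: incident_def fm_nonneg)

lemma fm_le_1:
  assumes "simple_graph E" "x \<in> fractional_matchings E"
  shows "x $ e \<le> 1"
proof (cases "e \<in> E")
  case True
  then obtain v where "v \<in> e"
    using assms(1) by (fastforce simp: simple_graph_def card_2_iff)
  then have "x $ e \<le> load E x v"
    using sum_le_load[of x E "{e}" v] True assms(2) by auto
  also have "\<dots> \<le> 1" using assms(2) by (simp add: fm_iff)
  finally show ?thesis .
qed (use assms(2) in \<open>auto simp: fm_iff\<close>)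

lemma load_cong_off:
  assumes "\<And>e. e \<in> E \<Longrightarrow> v \<in> e \<Longrightarrow> e \<notin> A \<Longrightarrow> x' $ e = x $ e"
    and "A \<subseteq> incident E v"
  shows "load E x' v = load E x v - (\<Sum>e\<in>A. x $ e) + (\<Sum>e\<in>A. x' $ e)"
proof -
  have "load E z v = (\<Sum>e\<in>incident E v - A. z $ e) + (\<Sum>e\<in>A. z $ e)" for z
    unfolding load_def using assms(2) by (intro sum.subset_diff) auto
  moreover have "(\<Sum>e\<in>incident E v - A. x' $ e) = (\<Sum>e\<in>incident E v - A. x $ e)"
    using assms(1) by (intro sum.cong) (auto simp: incident_def)
  ultimately show ?thesis by simp
qed

section \<open>Weak and strong LP duality\<close>

lemma cover_edge:
  assumes "simple_graph E" "y \<in> fractional_covers E w" "e \<in> E"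
  shows "w e \<le> (\<Sum>v\<in>e. y $ v)"
proof -
  obtain a b where "e = {a, b}" "a \<noteq> b"
    using assms(1,3) by (auto simp: simple_graph_def card_2_iff)
  then show ?thesis using assms(2,3) by (auto simp: fractional_covers_def)
qed

text \<open>The chain is kept in two links because equality between its ends forces equality in each
  link, and each link yields one half of complementary slackness.\<close>

lemma weak_duality:
  assumes "simple_graph E" "y \<in> fractional_covers E w" "x \<in> fractional_matchings E"
  shows "(\<Sum>e\<in>E. w e * x $ e) \<le> (\<Sum>e\<in>E. (\<Sum>v\<in>e. y $ v) * x $ e)"
    and "(\<Sum>e\<in>E. (\<Sum>v\<in>e. y $ v) * x $ e) \<le> (\<Sum>v\<in>UNIV. y $ v)"
proof -
  show "(\<Sum>e\<in>E. w e * x $ e) \<le> (\<Sum>e\<in>E. (\<Sum>v\<in>e. y $ v) * x $ e)"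
    using assms by (intro sum_mono mult_right_mono cover_edge) (auto simp: fm_nonneg)
  have "(\<Sum>e\<in>E. (\<Sum>v\<in>e. y $ v) * x $ e) = (\<Sum>v\<in>UNIV. y $ v * load E x v)"
    by (simp add: sum_load)
  also have "\<dots> \<le> (\<Sum>v\<in>UNIV. y $ v * 1)"
    using assms by (intro sum_mono mult_left_mono) (auto simp: fm_iff fractional_covers_def)
  finally show "(\<Sum>e\<in>E. (\<Sum>v\<in>e. y $ v) * x $ e) \<le> (\<Sum>v\<in>UNIV. y $ v)" by simp
qed

text \<open>Strong duality by separation. \<open>P\<close> consists of capacities \<open>b\<close>
  together with weights \<open>t\<close> attainable within them, \<open>Q\<close> of unit capacities
  with a weight above the optimum. A separating normal \<open>(c, s)\<close> has \<open>c\<close>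
  nonpositive and \<open>s\<close> positive, since \<open>P\<close> is closed under raising
  \<open>b\<close> and lowering \<open>t\<close>, and the cover is \<open>- c / s\<close>.\<close>

lemma cover_of_max_weight:
  fixes E :: "'v::finite set set"
  assumes "simple_graph E" "max_weight_fm E w x"
  obtains y where "y \<in> fractional_covers E w" "(\<Sum>v\<in>UNIV. y $ v) \<le> (\<Sum>e\<in>E. w e * x $ e)"
proof -
  define W where "W = (\<Sum>e\<in>E. w e * x $ e)"
  define Z where "Z = {z :: real^('v set). (\<forall>e. e \<notin> E \<longrightarrow> z $ e = 0) \<and> (\<forall>e. 0 \<le> z $ e)}"
  define P where "P = {(b :: real^'v, t :: real). \<exists>z\<in>Z. (\<forall>v. load E z v \<le> b $ v) \<and>
                          t \<le> (\<Sum>e\<in>E. w e * z $ e)}"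
  define Q where "Q = {(b :: real^'v, t :: real). b = (\<chi> v. 1) \<and> W < t}"
  have PI: "(b, t) \<in> P" if "z \<in> Z" "\<And>v. load E z v \<le> b $ v" "t \<le> (\<Sum>e\<in>E. w e * z $ e)" for b t z
    using that by (auto simp: P_def)
  have "convex P"
  proof (rule convexI)
    fix p q :: "(real^'v) \<times> real" and r s :: real
    assume pq: "p \<in> P" "q \<in> P" and rs: "0 \<le> r" "0 \<le> s" "r + s = 1"
    obtain z where z: "z \<in> Z" "\<And>v. load E z v \<le> fst p $ v" "snd p \<le> (\<Sum>e\<in>E. w e * z $ e)"
      using pq(1) by (auto simp: P_def)
    obtain z' where z': "z' \<in> Z" "\<And>v. load E z' v \<le> fst q $ v" "snd q \<le> (\<Sum>e\<in>E. w e * z' $ e)"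
      using pq(2) by (auto simp: P_def)
    have "(r *\<^sub>R fst p + s *\<^sub>R fst q, r *\<^sub>R snd p + s *\<^sub>R snd q) \<in> P"
    proof (rule PI[of "r *\<^sub>R z + s *\<^sub>R z'"])
      show "r *\<^sub>R z + s *\<^sub>R z' \<in> Z" using z(1) z'(1) rs by (auto simp: Z_def)
      show "load E (r *\<^sub>R z + s *\<^sub>R z') v \<le> (r *\<^sub>R fst p + s *\<^sub>R fst q) $ v" for v
        using z(2) z'(2) rs by (auto simp: load_add load_scaleR intro!: add_mono mult_left_mono)
      have "r * snd p + s * snd q \<le> r * (\<Sum>e\<in>E. w e * z $ e) + s * (\<Sum>e\<in>E. w e * z' $ e)"
        using z(3) z'(3) rs by (intro add_mono mult_left_mono) auto
      also have "\<dots> = (\<Sum>e\<in>E. w e * (r *\<^sub>R z + s *\<^sub>R z') $ e)"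
        by (simp add: sum_distrib_left sum.distrib[symmetric] algebra_simps)
      finally show "r *\<^sub>R snd p + s *\<^sub>R snd q \<le> (\<Sum>e\<in>E. w e * (r *\<^sub>R z + s *\<^sub>R z') $ e)" by simp
    qed
    then show "r *\<^sub>R p + s *\<^sub>R q \<in> P" by (simp add: scaleR_prod_def plus_prod_def)
  qed
  moreover have "convex Q"
  proof (rule convexI)
    fix p q :: "(real^'v) \<times> real" and r s :: real
    assume pq: "p \<in> Q" "q \<in> Q" and rs: "0 \<le> r" "0 \<le> s" "r + s = 1"
    have "W < r * snd p + s * snd q"
      using pq rs convexD[OF convex_real_interval(3)[of W], of "snd p" "snd q" r s]
      by (auto simp: Q_def)
    then show "r *\<^sub>R p + s *\<^sub>R q \<in> Q" using pq rs by (auto simp: Q_def vec_eq_iff distrib_right[symmetric])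
  qed
  moreover have "0 \<in> Z" by (simp add: Z_def)
  then have P0: "(0, 0) \<in> P" by (intro PI[of 0]) (auto simp: load_def)
  moreover have Q1: "((\<chi> v. 1), t) \<in> Q" if "W < t" for t using that by (simp add: Q_def)
  moreover have "P \<inter> Q = {}"
  proof (rule ccontr)
    assume "P \<inter> Q \<noteq> {}"
    then obtain t z where "W < t" "z \<in> Z" "\<forall>v. load E z v \<le> 1" "t \<le> (\<Sum>e\<in>E. w e * z $ e)"
      by (auto simp: P_def Q_def)
    moreover then have "z \<in> fractional_matchings E" by (auto simp: fm_iff Z_def)
    ultimately show False using assms(2) unfolding W_def max_weight_fm_def by fastforce
  qed
  moreover have "P \<noteq> {}" "Q \<noteq> {}" using P0 Q1[of "W + 1"] by auto
  ultimately obtain a \<beta>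
    where a: "a \<noteq> 0" "\<And>p. p \<in> P \<Longrightarrow> a \<bullet> p \<le> \<beta>" "\<And>q. q \<in> Q \<Longrightarrow> \<beta> \<le> a \<bullet> q"
    using separating_hyperplane_sets[of P Q] by metis
  obtain c s where as: "a = (c, s)" by (cases a)
  have P': "c \<bullet> b + s * t \<le> \<beta>" if "(b, t) \<in> P" for b t using a(2)[OF that] as by simp
  have Q': "\<beta> \<le> (\<Sum>v\<in>UNIV. c $ v) + s * t" if "W < t" for t
    using a(3)[OF Q1[OF that]] as by (simp add: inner_vec_def)
  have b0: "0 \<le> \<beta>" using P'[OF P0] by simp
  \<comment> \<open>A linear functional bounded on a ray cannot increase along it. This turns each
    ray in \<open>P\<close> into a sign condition on \<open>(c, s)\<close>.\<close>
  have bounded: "r \<le> 0" if "\<And>k. 0 \<le> k \<Longrightarrow> k * r \<le> \<beta>" for r :: real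
  proof (rule ccontr)
    assume "\<not> r \<le> 0"
    then show False using that[of "(\<beta> + 1) / r"] b0 by (simp add: field_simps)
  qed
  have s0: "0 \<le> s"
  proof -
    have "k * (- s) \<le> \<beta>" if "0 \<le> k" for k
      using P'[of 0 "- k"] that PI[OF \<open>0 \<in> Z\<close>, of 0 "- k"] by (simp add: load_def mult.commute)
    from bounded[OF this] show ?thesis by simp
  qed
  have c0: "c $ v \<le> 0" for v
  proof (rule bounded)
    fix k :: real assume "0 \<le> k"
    then have "(axis v k, 0) \<in> P" by (intro PI[of 0] \<open>0 \<in> Z\<close>) (auto simp: load_def axis_def)
    from P'[OF this] show "k * c $ v \<le> \<beta>" by (simp add: inner_axis mult.commute)
  qed
  \<comment> \<open>Slater's condition: the zero vector leaves slack at every vertex, so a vertical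
    hyperplane would need \<open>c\<close> to vanish as well.\<close>
  have "s \<noteq> 0"
  proof
    assume s: "s = 0"
    then have "0 \<le> (\<Sum>v\<in>UNIV. c $ v)" using Q'[of "W + 1"] b0 by simp
    then have "(\<Sum>v\<in>UNIV. - c $ v) = 0"
      using sum_nonneg[of UNIV "\<lambda>v. - c $ v"] c0 by (simp add: sum_negf)
    then have "c = 0" using c0 by (subst (asm) sum_nonneg_eq_0_iff) (auto simp: vec_eq_iff)
    then show False using a(1) as s by (simp add: zero_prod_def)
  qed
  then have s: "0 < s" using s0 by simp
  define y where "y = (\<chi> v. - c $ v / s)"
  have "w {u, v} \<le> y $ u + y $ v" if e: "{u, v} \<in> E" for u v
  proof -
    let ?z = "\<lambda>k. axis {u, v} k :: real^('v set)"
    have uv: "u \<noteq> v" using e assms(1) by (auto simp: simple_graph_def)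
    have ld: "load E (?z k) q = (if q \<in> {u, v} then k else 0)" for k q
      using e by (auto simp: load_def axis_def incident_def if_distrib cong: if_cong)
    \<comment> \<open>The ray that puts the value \<open>k\<close> on this single edge gives the
      cover inequality of the edge.\<close>
    have "c $ u + c $ v + s * w {u, v} \<le> 0"
    proof (rule bounded)
      fix k :: real assume k: "0 \<le> k"
      have "((\<chi> q. load E (?z k) q), k * w {u, v}) \<in> P"
        using e k by (intro PI[of "?z k"]) (auto simp: Z_def axis_def if_distrib cong: if_cong)
      from P'[OF this] have "c \<bullet> (\<chi> q. load E (?z k) q) + s * (k * w {u, v}) \<le> \<beta>" .
      moreover have "c \<bullet> (\<chi> q. load E (?z k) q) = (\<Sum>q\<in>{u, v}. c $ q * k)"
        unfolding inner_vec_def ld by (rule sum.mono_neutral_cong_right) auto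
      ultimately show "k * (c $ u + c $ v + s * w {u, v}) \<le> \<beta>"
        using uv by (simp add: algebra_simps)
    qed
    then show ?thesis using s by (simp add: y_def field_simps)
  qed
  then have "y \<in> fractional_covers E w"
    using c0 s by (auto simp: fractional_covers_def y_def divide_nonpos_pos)
  \<comment> \<open>\<open>Q\<close> has to exclude \<open>W\<close> itself to be disjoint from
    \<open>P\<close>, so the bound by \<open>W\<close> is reached only as a limit.\<close>
  moreover have "(\<Sum>v\<in>UNIV. y $ v) \<le> t" if "W < t" for t
  proof -
    have "0 \<le> (\<Sum>v\<in>UNIV. c $ v) + s * t" using Q'[OF that] b0 by simp
    moreover have "s * (\<Sum>v\<in>UNIV. y $ v) = - (\<Sum>v\<in>UNIV. c $ v)"
      using s by (simp add: y_def sum_distrib_left sum_negf)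
    ultimately have "s * (\<Sum>v\<in>UNIV. y $ v) \<le> s * t" by simp
    then show ?thesis using s by (simp only: mult_le_cancel_left_pos)
  qed
  then have "(\<Sum>v\<in>UNIV. y $ v) \<le> W" by (rule dense_ge)
  ultimately show thesis using that by (simp add: W_def)
qed

text \<open>Summing \<open>y\<close> over the edge as a set avoids naming its ends and matches the
  form of \<open>sum_load\<close>.\<close>

definition complementary ::
    "'v::finite set set \<Rightarrow> ('v set \<Rightarrow> real) \<Rightarrow> real^('v set) \<Rightarrow> real^'v \<Rightarrow> bool" where
  "complementary E w x y \<longleftrightarrow>
     (\<forall>e\<in>E. x $ e \<noteq> 0 \<longrightarrow> w e = (\<Sum>v\<in>e. y $ v)) \<and> (\<forall>v. y $ v \<noteq> 0 \<longrightarrow> load E x v = 1)"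

lemma max_weight_if_complementary:
  assumes "simple_graph E" "x \<in> fractional_matchings E" "y \<in> fractional_covers E w"
    and "complementary E w x y"
  shows "max_weight_fm E w x"
proof -
  have "(\<Sum>e\<in>E. w e * x $ e) = (\<Sum>e\<in>E. (\<Sum>v\<in>e. y $ v) * x $ e)"
    using assms(4) by (intro sum.cong) (auto simp: complementary_def)
  also have "\<dots> = (\<Sum>v\<in>UNIV. y $ v * load E x v)" by (simp add: sum_load)
  also have "\<dots> = (\<Sum>v\<in>UNIV. y $ v)"
    using assms(4) by (intro sum.cong) (auto simp: complementary_def)
  finally show ?thesis
    using weak_duality[OF assms(1,3)] assms(2) by (fastforce simp: max_weight_fm_def)
qed

text \<open>The cover obtained by separation bounds the value of the minimum cover \<open>y\<close>
  by the weight of \<open>x\<close>. The slacks in weak duality then sum to zero, and being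
  nonnegative they vanish one by one.\<close>

lemma complementary_if_max_weight:
  assumes "simple_graph E" "max_weight_fm E w x" "min_fractional_cover E w y"
  shows "complementary E w x y"
proof -
  have y: "y \<in> fractional_covers E w" and x: "x \<in> fractional_matchings E"
    using assms(2,3) by (auto simp: min_fractional_cover_def max_weight_fm_def)
  obtain y' where "y' \<in> fractional_covers E w" "(\<Sum>v\<in>UNIV. y' $ v) \<le> (\<Sum>e\<in>E. w e * x $ e)"
    using cover_of_max_weight[OF assms(1,2)] .
  then have le: "(\<Sum>v\<in>UNIV. y $ v) \<le> (\<Sum>e\<in>E. w e * x $ e)"
    using assms(3) by (fastforce simp: min_fractional_cover_def)
  have "(\<Sum>e\<in>E. (\<Sum>v\<in>e. y $ v) * x $ e - w e * x $ e) = 0"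
    using weak_duality[OF assms(1) y x] le by (simp add: sum_subtractf)
  then have "\<forall>e\<in>E. (\<Sum>v\<in>e. y $ v) * x $ e - w e * x $ e = 0"
    using cover_edge[OF assms(1) y] fm_nonneg[OF x]
    by (subst (asm) sum_nonneg_eq_0_iff) (auto intro: mult_right_mono)
  moreover have "(\<Sum>v\<in>UNIV. y $ v * (1 - load E x v)) = 0"
    using weak_duality[OF assms(1) y x] le by (simp add: sum_load algebra_simps sum_subtractf)
  then have "\<forall>v\<in>UNIV. y $ v * (1 - load E x v) = 0"
    using x y by (subst (asm) sum_nonneg_eq_0_iff) (auto simp: fm_iff fractional_covers_def)
  ultimately show ?thesis by (auto simp: complementary_def)
qed

subsection \<open>Half-integral structure\<close>

lemma Suc_mod_less: "i < n \<Longrightarrow> Suc i mod n < n"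
  by simp

lemma length_path_edges [simp]: "length (path_edges p) = length p - 1"
  by (simp add: path_edges_def)

lemma path_edges_nth: "Suc i < length p \<Longrightarrow> path_edges p ! i = {p ! i, p ! Suc i}"
  by (simp add: path_edges_def nth_tl)

lemma length_cycle_edges [simp]: "length (cycle_edges c) = length c"
  by (simp add: cycle_edges_def)

lemma cycle_edges_nth:
  assumes "i < length c"
  shows "cycle_edges c ! i = {c ! i, c ! (Suc i mod length c)}"
proof -
  have "cycle_edges c ! i = {c ! i, (c @ [hd c]) ! Suc i}"
    using assms by (simp add: cycle_edges_def path_edges_nth nth_append)
  also have "(c @ [hd c]) ! Suc i = c ! (Suc i mod length c)"
    using assms by (cases c; cases "Suc i = length c") (auto simp: nth_append)
  finally show ?thesis .
qed

text \<open>Two positions carrying the same edge would be cyclic successors of each other, which a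
  length of at least 3 rules out.\<close>

lemma cycle_edges_inj:
  assumes "3 \<le> length c" "distinct c" "i < length c" "j < length c"
    and "cycle_edges c ! i = cycle_edges c ! j"
  shows "i = j"
proof (rule ccontr)
  assume "i \<noteq> j"
  have less: "Suc k mod length c < length c" if "k < length c" for k using Suc_mod_less[OF that] .
  have "c ! i \<noteq> c ! j" using assms \<open>i \<noteq> j\<close> by (simp add: nth_eq_iff_index_eq)
  then have "c ! i = c ! (Suc j mod length c)" "c ! (Suc i mod length c) = c ! j"
    using assms(5) by (auto simp: cycle_edges_nth[OF assms(3)] cycle_edges_nth[OF assms(4)] doubleton_eq_iff)
  then have "i = Suc j mod length c" "Suc i mod length c = j"
    using assms(2-4) less[OF assms(3)] less[OF assms(4)] by (simp_all add: nth_eq_iff_index_eq)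
  then show False using assms(1,3,4) by (auto simp: mod_Suc split: if_splits)
qed

lemma Union_cycle_edges: "\<Union> (set (cycle_edges c)) = set c"
proof
  show "\<Union> (set (cycle_edges c)) \<subseteq> set c"
    using Union_path_edges[of "c @ [hd c]"]
    by (cases c) (auto simp: cycle_edges_def path_edges_def)
  show "set c \<subseteq> \<Union> (set (cycle_edges c))"
  proof
    fix v assume "v \<in> set c"
    then obtain i where "i < length c" "v = c ! i" by (auto simp: in_set_conv_nth)
    then have "v \<in> cycle_edges c ! i" by (simp add: cycle_edges_nth)
    moreover have "cycle_edges c ! i \<in> set (cycle_edges c)" using \<open>i < length c\<close> by simp
    ultimately
    show "v \<in> \<Union> (set (cycle_edges c))" by blast
  qed
qed

text \<open>Addressing a vertex through its predecessor gives the two cycle edges at it the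
  positions \<open>i\<close> and \<open>Suc i mod length c\<close>, also at the wrap-around.\<close>

lemma cycle_vertex_conv:
  assumes "v \<in> set c"
  obtains i where "i < length c" "v = c ! (Suc i mod length c)"
proof -
  obtain k where k: "k < length c" "v = c ! k" using assms by (auto simp: in_set_conv_nth)
  show thesis
  proof (cases k)
    case 0
    then show ?thesis using k that[of "length c - 1"] by simp
  next
    case (Suc i)
    then show ?thesis using k that[of i] by simp
  qed
qed

lemma cycle_incident:
  assumes "3 \<le> length c" "distinct c" "i < length c" "j = Suc i mod length c"
  shows "{e \<in> set (cycle_edges c). c ! j \<in> e} = {cycle_edges c ! i, cycle_edges c ! j}"
    and "cycle_edges c ! i \<noteq> cycle_edges c ! j"
proof -
  have j: "j < length c" unfolding assms(4) by (rule Suc_mod_less[OF assms(3)])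
  have "i \<noteq> j" using assms by (auto simp: mod_Suc split: if_splits)
  then show "cycle_edges c ! i \<noteq> cycle_edges c ! j"
    using cycle_edges_inj assms j by blast
  show "{e \<in> set (cycle_edges c). c ! j \<in> e} = {cycle_edges c ! i, cycle_edges c ! j}"
  proof (intro equalityI subsetI)
    fix e assume "e \<in> {e \<in> set (cycle_edges c). c ! j \<in> e}"
    then obtain k where k: "k < length c" "e = cycle_edges c ! k" "c ! j \<in> cycle_edges c ! k"
      by (auto simp: in_set_conv_nth)
    have "Suc k mod length c < length c" by (rule Suc_mod_less[OF k(1)])
    then have "j = k \<or> j = Suc k mod length c"
      using k j assms(2) by (auto simp: cycle_edges_nth nth_eq_iff_index_eq)
    then have "j = k \<or> i = k"
      using assms(3,4) k(1) by (auto simp: mod_Suc split: if_splits)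
    then show "e \<in> {cycle_edges c ! i, cycle_edges c ! j}" using k(2) by blast
  next
    fix e assume "e \<in> {cycle_edges c ! i, cycle_edges c ! j}"
    moreover have "c ! j \<in> cycle_edges c ! i" "c ! j \<in> cycle_edges c ! j"
      using j assms(3) by (simp_all add: cycle_edges_nth assms(4))
    moreover have "cycle_edges c ! i \<in> set (cycle_edges c)" "cycle_edges c ! j \<in> set (cycle_edges c)"
      using j assms(3) by simp_all
    ultimately show "e \<in> {e \<in> set (cycle_edges c). c ! j \<in> e}" by blast
  qed
qed

text \<open>Stated for an arbitrary vector \<open>d\<close>, because it is applied to matchings, to
  rounded vectors and to perturbations with negative entries.\<close>

lemma load_cycle:
  assumes "is_cycle E c" "i < length c" "j = Suc i mod length c"
    and "\<And>e. e \<in> E \<Longrightarrow> c ! j \<in> e \<Longrightarrow> e \<notin> set (cycle_edges c) \<Longrightarrow> d $ e = 0"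
  shows "load E d (c ! j) = d $ (cycle_edges c ! i) + d $ (cycle_edges c ! j)"
proof -
  have c: "3 \<le> length c" "distinct c" "set (cycle_edges c) \<subseteq> E" using assms(1) by (auto simp: is_cycle_def)
  have "load E d (c ! j) = (\<Sum>e\<in>{e \<in> set (cycle_edges c). c ! j \<in> e}. d $ e)"
    unfolding load_def using c(3) assms(4)
    by (intro sum.mono_neutral_right) (auto simp: incident_def)
  then show ?thesis using cycle_incident[OF c(1,2) assms(2,3)] by simp
qed

section \<open>Saturation and disjointness of half cycles\<close>

lemma half_cycleE:
  assumes "C \<in> half_cycles E x"
  obtains c where "is_cycle E c" "odd (length c)" "C = set (cycle_edges c)" "\<Union> C = set c"
    "\<And>e. e \<in> C \<Longrightarrow> e \<in> E \<and> x $ e = 1/2"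
  using assms by (auto simp: half_cycles_def Union_cycle_edges is_cycle_def)

text \<open>The two cycle edges at \<open>u\<close> already use up its capacity, so a further edge
  of positive value would overload it.\<close>

lemma half_cycle_edge:
  assumes x: "x \<in> fractional_matchings E" and C: "C \<in> half_cycles E x"
    and "u \<in> \<Union> C" "e \<in> E" "u \<in> e" "x $ e \<noteq> 0"
  shows "e \<in> C"
proof (rule ccontr)
  assume e: "e \<notin> C"
  obtain c where c: "is_cycle E c" "odd (length c)" "C = set (cycle_edges c)" "\<Union> C = set c"
    "\<And>e. e \<in> C \<Longrightarrow> e \<in> E \<and> x $ e = 1/2"
    using C by (rule half_cycleE) blast
  then have c': "3 \<le> length c" "distinct c" by (auto simp: is_cycle_def)
  obtain i where i: "i < length c" "u = c ! (Suc i mod length c)"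
    using assms(3) c(4) cycle_vertex_conv by metis
  note inc = cycle_incident[OF c' i(1) refl, folded c(3)]
  have "0 < x $ e" using x assms(6) by (simp add: fm_nonneg order_less_le)
  moreover have "(\<Sum>e\<in>insert e {f \<in> C. c ! (Suc i mod length c) \<in> f}. x $ e) \<le> load E x u"
    using assms i c(5) by (intro sum_le_load) auto
  moreover have "(\<Sum>e\<in>insert e {f \<in> C. c ! (Suc i mod length c) \<in> f}. x $ e)
       = x $ e + (\<Sum>e\<in>{f \<in> C. c ! (Suc i mod length c) \<in> f}. x $ e)"
    using e by (intro sum.insert) auto
  moreover have "(\<Sum>e\<in>{f \<in> C. c ! (Suc i mod length c) \<in> f}. x $ e) =
       (\<Sum>e\<in>{f \<in> C. c ! (Suc i mod length c) \<in> f}. 1/2)"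
    using c(5) by (intro sum.cong) auto
  moreover have "\<dots> = 1" using inc by simp
  moreover have "load E x u \<le> 1" using x by (simp add: fm_iff)
  ultimately show False by linarith
qed

lemma half_cycle_load:
  assumes x: "x \<in> fractional_matchings E" and C: "C \<in> half_cycles E x" and "u \<in> \<Union> C"
  shows "load E x u = 1"
proof -
  obtain c where c: "is_cycle E c" "odd (length c)" "C = set (cycle_edges c)" "\<Union> C = set c"
    "\<And>e. e \<in> C \<Longrightarrow> e \<in> E \<and> x $ e = 1/2"
    using C by (rule half_cycleE) blast
  obtain i where i: "i < length c" "u = c ! (Suc i mod length c)"
    using assms(3) c(4) cycle_vertex_conv by metis
  have "Suc i mod length c < length c" using i by (intro Suc_mod_less)
  then have half: "x $ (cycle_edges c ! i) = 1/2" "x $ (cycle_edges c ! (Suc i mod length c)) = 1/2"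
    using c(3,5) i by simp_all
  have "load E x u = x $ (cycle_edges c ! i) + x $ (cycle_edges c ! (Suc i mod length c))"
    unfolding i(2) using half_cycle_edge[OF x C assms(3)] c(3) i(2)
    by (intro load_cycle[OF c(1) i(1)]) auto
  then show ?thesis using half by simp
qed

text \<open>Go round \<open>D\<close> from the common vertex: by \<open>half_cycle_edge\<close> each
  edge lies in \<open>C\<close>, and with it the next vertex.\<close>

lemma half_cycles_disjoint:
  assumes x: "x \<in> fractional_matchings E" and C: "C \<in> half_cycles E x" and D: "D \<in> half_cycles E x"
    and u: "u \<in> \<Union> C" "u \<in> \<Union> D"
  shows "C = D"
proof -
  have "D \<subseteq> C" if C: "C \<in> half_cycles E x" and D: "D \<in> half_cycles E x"
    and u: "u \<in> \<Union> C" "u \<in> \<Union> D" for C D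
  proof -
    obtain d where d: "is_cycle D d" "hd d = u" "set (cycle_edges d) = D"
      using traversal_ex[OF D u(2)] by auto
    have half: "e \<in> E \<and> x $ e = 1/2" if "e \<in> D" for e using that D by (rule_tac half_cycleE) auto
    have "i < length d \<Longrightarrow> d ! i \<in> \<Union> C \<and> cycle_edges d ! i \<in> C" for i
    proof (induction i)
      case 0
      then have "u = d ! 0" using d(2) by (simp add: hd_conv_nth)
      moreover have "cycle_edges d ! 0 \<in> D" using 0 d(3) by auto
      ultimately show ?case
        using half_cycle_edge[OF x C u(1), of "cycle_edges d ! 0"] half 0 u(1)
        by (auto simp: cycle_edges_nth)
    next
      case (Suc i)
      have "d ! Suc i \<in> cycle_edges d ! i" using Suc by (simp add: cycle_edges_nth)
      then have v: "d ! Suc i \<in> \<Union> C" using Suc by auto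
      moreover have "cycle_edges d ! Suc i \<in> D" using Suc.prems d(3) by auto
      ultimately show ?case
        using half_cycle_edge[OF x C v, of "cycle_edges d ! Suc i"] half Suc.prems
        by (auto simp: cycle_edges_nth)
    qed
    then show ?thesis using d(3) by (auto simp: in_set_conv_nth)
  qed
  from this[OF C D u] this[OF D C u(2,1)] show ?thesis by auto
qed

text \<open>The combinatorial counterpart of extremality; it can be checked directly after rounding
  or complementing. The value one half is carried by membership in a half cycle.\<close>

definition half_struct :: "'v::finite set set \<Rightarrow> real^('v set) \<Rightarrow> bool" where
  "half_struct E x \<longleftrightarrow> x \<in> fractional_matchings E \<and>
     (\<forall>e\<in>E. x $ e = 0 \<or> x $ e = 1 \<or> e \<in> \<Union> (half_cycles E x))"

text \<open>The values alternate between \<open>z 0\<close> and \<open>1 - z 0\<close>; for odd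
  \<open>n\<close> the closing equation pairs \<open>z 0\<close> with an equal value.\<close>

lemma alternating_odd_cycle:
  fixes z :: "nat \<Rightarrow> real"
  assumes "odd n" "\<And>i. i < n \<Longrightarrow> z i + z (Suc i mod n) = 1" "i < n"
  shows "z i = 1/2"
proof -
  have alt: "i < n \<Longrightarrow> z i = (if even i then z 0 else 1 - z 0)" for i
  proof (induction i)
    case (Suc i)
    then show ?case using assms(2)[of i] by auto
  qed simp
  have "even (n - 1)" "n - 1 < n" using assms(1) by (auto simp: odd_pos)
  then have "z 0 + z 0 = 1" using alt[of "n - 1"] assms(2)[of "n - 1"] by simp
  then show ?thesis using alt[OF assms(3)] by auto
qed

lemma extreme_if_half_struct:
  assumes "simple_graph E" "half_struct E x"
  shows "x extreme_point_of fractional_matchings E"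
  unfolding extreme_point_of_def
proof (intro conjI ballI notI)
  show x: "x \<in> fractional_matchings E" using assms(2) by (simp add: half_struct_def)
  fix a b assume ab: "a \<in> fractional_matchings E" "b \<in> fractional_matchings E" "x \<in> open_segment a b"
  then obtain t where t: "0 < t" "t < 1" "x = (1 - t) *\<^sub>R a + t *\<^sub>R b" "a \<noteq> b"
    by (auto simp: in_segment)
  \<comment> \<open>The zeros, ones and saturated vertices of \<open>x\<close> determine it: around
    an odd cycle the saturated loads leave one half as the only solution. Both ends of the segment
    inherit these equations.\<close>
  have "z = x" if z: "z \<in> fractional_matchings E" and zero: "\<And>e. x $ e = 0 \<Longrightarrow> z $ e = 0"
    and one: "\<And>e. x $ e = 1 \<Longrightarrow> z $ e = 1" and ld: "\<And>v. load E x v = 1 \<Longrightarrow> load E z v = 1" for z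
  proof -
    have "z $ e = x $ e" for e
    proof (cases "x $ e = 0 \<or> x $ e = 1")
      case False
      then have "e \<in> E" using x by (auto simp: fm_iff)
      then obtain C where C: "C \<in> half_cycles E x" "e \<in> C" using False assms(2) by (auto simp: half_struct_def)
      then obtain c where c: "is_cycle E c" "odd (length c)" "C = set (cycle_edges c)" "\<Union> C = set c"
        "\<And>e. e \<in> C \<Longrightarrow> e \<in> E \<and> x $ e = 1/2"
        by (rule_tac half_cycleE) blast+
      obtain k where k: "k < length c" "e = cycle_edges c ! k"
        using C(2) c(3) by (auto simp: in_set_conv_nth)
      have "z $ (cycle_edges c ! k) = 1/2"
      proof (rule alternating_odd_cycle[OF c(2) _ k(1)])
        fix i assume i: "i < length c"
        let ?j = "Suc i mod length c"
        have "?j < length c" using i by (intro Suc_mod_less)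
        then have u: "c ! ?j \<in> \<Union> C" using c(4) by simp
        have "z $ (cycle_edges c ! i) + z $ (cycle_edges c ! ?j) = load E z (c ! ?j)"
          using half_cycle_edge[OF x C(1) u] c(3) zero
          by (intro load_cycle[OF c(1) i refl, symmetric]) auto
        also have "\<dots> = 1" by (rule ld[OF half_cycle_load[OF x C(1) u]])
        finally show "z $ (cycle_edges c ! i) + z $ (cycle_edges c ! ?j) = 1" .
      qed
      then show ?thesis using c(5)[OF C(2)] k by simp
    qed (use zero one in auto)
    then show ?thesis by (simp add: vec_eq_iff)
  qed
  note eq = this
  \<comment> \<open>A proper convex combination reaches an upper bound only if both of its members
    do.\<close>
  have one: "p = 1 \<and> q = 1" if "p \<le> 1" "q \<le> 1" "(1 - t) * p + t * q = 1" for p q :: real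
  proof -
    have "(1 - t) * (1 - p) + t * (1 - q) = 0" using that by (simp add: algebra_simps)
    moreover have "0 \<le> (1 - t) * (1 - p)" "0 \<le> t * (1 - q)" using that t by auto
    ultimately show ?thesis using t by (auto simp: add_nonneg_eq_0_iff)
  qed
  have zero: "p = 0 \<and> q = 0" if "0 \<le> p" "0 \<le> q" "(1 - t) * p + t * q = 0" for p q :: real
    using that t one[of "1 - p" "1 - q"] by (auto simp: algebra_simps)
  have xe: "x $ e = (1 - t) * a $ e + t * b $ e" for e using t(3) by simp
  have xl: "load E x v = (1 - t) * load E a v + t * load E b v" for v
    using t(3) by (simp add: load_add load_scaleR)
  have 1: "a $ e = 1 \<and> b $ e = 1" if "x $ e = 1" for e
    using one[of "a $ e" "b $ e"] that xe[of e] fm_le_1[OF assms(1)] ab by simp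
  have 0: "a $ e = 0 \<and> b $ e = 0" if "x $ e = 0" for e
    using zero[of "a $ e" "b $ e"] that xe[of e] fm_nonneg[OF ab(1)] fm_nonneg[OF ab(2)] by simp
  have L: "load E a v = 1 \<and> load E b v = 1" if "load E x v = 1" for v
    using one[of "load E a v" "load E b v"] that xl[of v] ab by (simp add: fm_iff)
  have "a = x" "b = x" using eq[of a] eq[of b] ab 0 1 L by blast+
  then show False using t(4) by simp
qed

subsection \<open>Basic fractional matchings\<close>

text \<open>Provides one step length that respects finitely many slacks \<open>p\<close> when moving
  in direction \<open>q\<close> or in its opposite.\<close>

lemma small_multiple:
  fixes p q :: "'a \<Rightarrow> real"
  assumes "finite A" "\<And>a. a \<in> A \<Longrightarrow> 0 \<le> p a" "\<And>a. a \<in> A \<Longrightarrow> q a \<noteq> 0 \<Longrightarrow> 0 < p a"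
  shows "\<exists>r>0. \<forall>a\<in>A. r * \<bar>q a\<bar> \<le> p a"
  using assms
proof (induction rule: finite_induct)
  case empty
  then show ?case by (intro exI[of _ 1]) simp
next
  case (insert a A)
  then obtain r where r: "0 < r" "\<forall>a\<in>A. r * \<bar>q a\<bar> \<le> p a" by auto
  obtain s where s: "0 < s" "s * \<bar>q a\<bar> \<le> p a"
  proof (cases "q a = 0")
    case True
    then show ?thesis using that[of 1] insert.prems(1) by simp
  next
    case False
    then show ?thesis using that[of "p a / \<bar>q a\<bar>"] insert.prems(2)[of a] by simp
  qed
  have "min r s * \<bar>q b\<bar> \<le> r * \<bar>q b\<bar>" "min r s * \<bar>q b\<bar> \<le> s * \<bar>q b\<bar>" for b
    by (intro mult_right_mono; simp)+
  then have "\<forall>b\<in>insert a A. min r s * \<bar>q b\<bar> \<le> p b"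
    using r(2) s(2) by (auto intro: order_trans)
  then show ?case using r(1) s(1) by (intro exI[of _ "min r s"]) simp
qed

text \<open>A direction that stays within the support and keeps the saturated loads can be followed
  a little both ways, which makes \<open>x\<close> a midpoint of feasible points unless the
  direction is zero.\<close>

lemma extreme_perturbation:
  assumes ext: "x extreme_point_of fractional_matchings E"
    and supp: "\<And>e. d $ e \<noteq> 0 \<Longrightarrow> x $ e \<noteq> 0"
    and ld: "\<And>v. load E x v = 1 \<Longrightarrow> load E d v = 0"
  shows "d = 0"
proof (rule ccontr)
  assume "d \<noteq> 0"
  have x: "x \<in> fractional_matchings E" using ext by (simp add: extreme_point_of_def)
  obtain r where r: "0 < r" "\<And>e. r * \<bar>d $ e\<bar> \<le> x $ e"
    using small_multiple[of UNIV "\<lambda>e. x $ e" "\<lambda>e. d $ e"] fm_nonneg[OF x] supp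
    by (force simp: order_less_le)
  have "load E x v < 1" if "load E d v \<noteq> 0" for v
    using that ld[of v] x unfolding fm_iff by (metis order_less_le)
  then obtain s where s: "0 < s" "\<And>v. s * \<bar>load E d v\<bar> \<le> 1 - load E x v"
    using small_multiple[of UNIV "\<lambda>v. 1 - load E x v" "\<lambda>v. load E d v"] x
    by (force simp: fm_iff)
  define t where "t = min r s"
  have fm: "x + k *\<^sub>R d \<in> fractional_matchings E" if "\<bar>k\<bar> = t" for k
    unfolding fm_iff
  proof (intro conjI allI impI ballI)
    fix e
    have "\<bar>k * d $ e\<bar> \<le> r * \<bar>d $ e\<bar>"
      unfolding abs_mult that by (intro mult_right_mono) (auto simp: t_def)
    then show "0 \<le> (x + k *\<^sub>R d) $ e" using r(2)[of e] by simp
    assume "e \<notin> E"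
    then show "(x + k *\<^sub>R d) $ e = 0" using x supp[of e] by (auto simp: fm_iff)
  next
    fix v
    have "\<bar>k * load E d v\<bar> \<le> s * \<bar>load E d v\<bar>"
      unfolding abs_mult that by (intro mult_right_mono) (auto simp: t_def)
    then show "load E (x + k *\<^sub>R d) v \<le> 1" using s(2)[of v] by (simp add: load_add load_scaleR)
  qed
  have t: "0 < t" using r(1) s(1) by (simp add: t_def)
  have "x + t *\<^sub>R d \<noteq> x + (- t) *\<^sub>R d" using t \<open>d \<noteq> 0\<close>
    by (simp add: scaleR_left.minus eq_neg_iff_add_eq_0 flip: scaleR_left.add)
  moreover have "midpoint (x + t *\<^sub>R d) (x + (- t) *\<^sub>R d) = x"
    by (simp add: midpoint_def vec_eq_iff)
  ultimately have "x \<in> open_segment (x + t *\<^sub>R d) (x + (- t) *\<^sub>R d)"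
    using midpoint_in_open_segment[of "x + t *\<^sub>R d" "x + (- t) *\<^sub>R d"] by metis
  moreover have "x + t *\<^sub>R d \<in> fractional_matchings E" "x + (- t) *\<^sub>R d \<in> fractional_matchings E"
    using fm[of t] fm[of "- t"] t by auto
  ultimately show False using ext unfolding extreme_point_of_def by blast
qed

text \<open>Restricting \<^const>\<open>load\<close> to the saturated end points of the fractional edges is injective by
  extremality, so there are at most as many fractional edges as such vertices, while each of these
  vertices meets at least two fractional edges.\<close>

lemma extreme_fractional_degree:
  fixes E :: "'v::finite set set"
  assumes simple: "simple_graph E" and ext: "x extreme_point_of fractional_matchings E"
  defines "F \<equiv> {e \<in> E. x $ e \<noteq> 0 \<and> x $ e \<noteq> 1}"
  assumes "e \<in> F" "v \<in> e"
  shows "card {f \<in> F. v \<in> f} = 2" and "load E x v = 1"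
proof -
  have x: "x \<in> fractional_matchings E" using ext by (simp add: extreme_point_of_def)
  define T where "T = {v. load E x v = 1 \<and> (\<exists>e\<in>F. v \<in> e)}"
  define U where "U = {d :: real^('v set). \<forall>e. e \<notin> F \<longrightarrow> d $ e = 0}"
  define S where "S = {b :: real^'v. \<forall>v. v \<notin> T \<longrightarrow> b $ v = 0}"
  define L where "L d = (\<chi> v. if v \<in> T then load E d v else 0)" for d :: "real^('v set)"
  have lin: "linear L"
    by (intro linearI) (auto simp: L_def vec_eq_iff load_add load_scaleR)
  have sub: "subspace U" by (auto simp: U_def subspace_def)
  have "d = 0" if d: "d \<in> U" "L d = 0" for d
  proof (rule extreme_perturbation[OF ext])
    show "x $ e \<noteq> 0" if "d $ e \<noteq> 0" for e using that d(1) by (auto simp: U_def F_def)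
    fix v assume v: "load E x v = 1"
    show "load E d v = 0"
    proof (cases "v \<in> T")
      case True
      then show ?thesis using d(2) by (auto simp: L_def vec_eq_iff split: if_splits)
    next
      case False
      then have "\<forall>e\<in>incident E v. d $ e = 0" using v d(1) by (auto simp: T_def U_def incident_def)
      then show ?thesis by (simp add: load_def)
    qed
  qed
  then have "inj_on L (span U)"
    using sub by (simp add: linear_inj_on_iff_eq_0[OF lin] span_eq_iff[THEN iffD2])
  then have "card F = dim (L ` U)"
    using dim_image_eq[OF lin] dim_substandard_cart[where 'a = real and d = F] by (simp add: U_def dim_vec_eq)
  also have "\<dots> \<le> dim S" by (intro dim_subset) (auto simp: L_def S_def)
  also have "\<dots> = card T" using dim_substandard_cart[where 'a = real and d = T] by (simp add: S_def dim_vec_eq)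
  finally have FT: "card F \<le> card T" .

  \<comment> \<open>One fractional edge leaves a remainder strictly between 0 and 1 at a saturated
    vertex, so another edge there is positive, and it is too small to have value 1.\<close>
  have ge2: "2 \<le> card {f \<in> F. v \<in> f}" if v: "v \<in> T" for v
  proof -
    obtain e where e: "e \<in> F" "v \<in> e" "load E x v = 1" using v by (auto simp: T_def)
    then have "0 < x $ e" "x $ e < 1"
      using fm_nonneg[OF x, of e] fm_le_1[OF simple x, of e] by (auto simp: F_def)
    moreover have "(\<Sum>f\<in>incident E v - {e}. x $ f) = 1 - x $ e"
      using e by (subst sum_diff1) (auto simp: load_def F_def incident_def)
    ultimately obtain f where f: "f \<in> incident E v - {e}" "x $ f \<noteq> 0"
      by (metis diff_gt_0_iff_gt less_irrefl sum.neutral)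
    have "(\<Sum>g\<in>{e, f}. x $ g) \<le> load E x v"
      using e f by (intro sum_le_load[OF x]) (auto simp: incident_def F_def)
    moreover have "e \<noteq> f" using f by blast
    ultimately have "x $ f \<noteq> 1" using e(3) \<open>0 < x $ e\<close> by auto
    then have "{e, f} \<subseteq> {f \<in> F. v \<in> f}" using e f by (auto simp: F_def incident_def)
    then have "card {e, f} \<le> card {f \<in> F. v \<in> f}" by (intro card_mono) auto
    then show ?thesis using \<open>e \<noteq> f\<close> by simp
  qed
  have "(\<Sum>v\<in>UNIV. card {f \<in> F. v \<in> f}) = (\<Sum>v\<in>UNIV. \<Sum>f | f \<in> F \<and> v \<in> f. 1)" by simp
  also have "\<dots> = (\<Sum>f\<in>F. \<Sum>v | v \<in> UNIV \<and> v \<in> f. 1)"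
    by (rule sum.swap_restrict) auto
  also have "\<dots> = (\<Sum>f\<in>F. 2)"
    using simple by (intro sum.cong) (auto simp: simple_graph_def F_def)
  finally have deg: "(\<Sum>v\<in>UNIV. card {f \<in> F. v \<in> f}) = 2 * card F" by simp
  have T2: "(\<Sum>v\<in>UNIV. if v \<in> T then 2 else 0) = 2 * card T"
    by (simp add: sum.If_cases)
  have le: "(if v \<in> T then 2 else 0) \<le> card {f \<in> F. v \<in> f}" for v using ge2[of v] by simp
  have "(\<Sum>v\<in>UNIV. if v \<in> T then 2 else 0) \<le> (\<Sum>v\<in>UNIV. card {f \<in> F. v \<in> f})"
    using le by (rule sum_mono)
  \<comment> \<open>The bounds close up: twice \<open>card T\<close> is at most the degree sum,
    which is twice \<open>card F\<close> and hence at most twice \<open>card T\<close>. Equality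
    must then hold at every vertex, so vertices outside \<open>T\<close> meet no fractional edge at
    all.\<close>
  then have sums: "(\<Sum>v\<in>UNIV. if v \<in> T then 2 else 0) = (\<Sum>v\<in>UNIV. card {f \<in> F. v \<in> f})"
    using deg T2 FT by linarith
  have eq: "(if v \<in> T then 2 else 0) = card {f \<in> F. v \<in> f}"
    by (rule sum_mono_inv[OF sums le]) auto
  moreover have "card {f \<in> F. v \<in> f} \<noteq> 0" using assms(4,5) by auto
  ultimately have "v \<in> T" by (auto split: if_splits)
  then show "card {f \<in> F. v \<in> f} = 2" "load E x v = 1"
    using eq by (auto simp: T_def)
qed

text \<open>Take a longest path beginning with \<open>e\<close>. The second edge at its last vertex
  leads back to the path by maximality, and only to its first vertex, because an inner vertex would
  get degree three.\<close>

lemma two_regular_cycle: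
  fixes F :: "'v::finite set set"
  assumes F: "simple_graph F" and deg: "\<And>v. v \<in> \<Union> F \<Longrightarrow> card {f \<in> F. v \<in> f} = 2" and "e \<in> F"
  obtains c where "is_cycle F c" "e \<in> set (cycle_edges c)"
proof -
  obtain a b where ab: "e = {a, b}" "a \<noteq> b"
    using F assms(3) by (auto simp: simple_graph_def card_2_iff)
  \<comment> \<open>Fixing the first two vertices keeps \<open>e\<close> at position 0 of the cycle
    that is finally closed.\<close>
  define P where "P p \<longleftrightarrow> is_path F p \<and> 2 \<le> length p \<and> p ! 0 = a \<and> p ! 1 = b" for p
  have "P [a, b]" using ab assms(3) by (simp add: P_def is_path_def path_edges_def)
  moreover have "length p \<le> card (UNIV :: 'v set)" if "P p" for p
  proof -
    have "length p = card (set p)" using that by (simp add: P_def is_path_def distinct_card)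
    then show ?thesis by (simp add: card_mono)
  qed
  ultimately obtain p where p: "P p" and max: "\<And>q. P q \<Longrightarrow> length q \<le> length p"
    using ex_has_greatest_nat[of P "[a, b]" length "Suc (card (UNIV :: 'v set))"]
    by (auto simp: less_Suc_eq_le)
  define k where "k = length p - 1"
  have k: "length p = Suc k" "1 \<le> k" using p by (auto simp: P_def k_def)
  have dist: "distinct p" and pF: "set (path_edges p) \<subseteq> F" using p by (auto simp: P_def is_path_def)
  have edge: "{p ! i, p ! Suc i} \<in> F" if "i < k" for i
    using that pF k nth_mem[of i "path_edges p"] by (auto simp: path_edges_nth)
  have three: False if "u \<noteq> v" "v \<noteq> z" "u \<noteq> z" "{q, u} \<in> F" "{q, v} \<in> F" "{q, z} \<in> F" for q u v z
  proof -
    have "card {{q, u}, {q, v}, {q, z}} \<le> card {f \<in> F. q \<in> f}"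
      using that by (intro card_mono) auto
    moreover have "card {{q, u}, {q, v}, {q, z}} = 3"
      using that by (simp add: doubleton_eq_iff)
    ultimately show False using deg[of q] that(4) by auto
  qed
  obtain j where j: "j + 1 = k" using k(2) by (metis le_add_diff_inverse2)
  have "{p ! j, p ! k} \<in> F" using edge[of j] j by simp
  then have "card {f \<in> F. p ! k \<in> f} = 2" by (intro deg) auto
  then have "card ({f \<in> F. p ! k \<in> f} - {{p ! j, p ! k}}) = 1"
    using \<open>{p ! j, p ! k} \<in> F\<close> by (subst card_Diff_singleton) auto
  then obtain f where f: "f \<in> F" "p ! k \<in> f" "f \<noteq> {p ! j, p ! k}" by (auto simp: card_1_singleton_iff)
  obtain u v where "f = {u, v}" "u \<noteq> v"
    using F f(1) by (auto simp: simple_graph_def card_2_iff)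
  then obtain q where q: "f = {p ! k, q}" "q \<noteq> p ! k"
    using f(2) by (auto simp: insert_commute)
  have qj: "q \<noteq> p ! j" using f(3) q(1) by auto
  have "q \<in> set p"
  proof (rule ccontr)
    assume "q \<notin> set p"
    have "set (path_edges (p @ [q])) \<subseteq> F"
    proof
      fix g assume "g \<in> set (path_edges (p @ [q]))"
      then obtain i where "i < length p" "g = path_edges (p @ [q]) ! i"
        by (auto simp: in_set_conv_nth)
      then have i: "i \<le> k" "g = {(p @ [q]) ! i, (p @ [q]) ! Suc i}"
        using k by (auto simp: path_edges_nth)
      show "g \<in> F"
      proof (cases "i = k")
        case True
        then show ?thesis using i k f q by (simp add: nth_append)
      next
        case False
        then show ?thesis using i k edge[of i] by (simp add: nth_append)
      qed
    qed
    then have "P (p @ [q])" using p \<open>q \<notin> set p\<close> by (auto simp: P_def is_path_def nth_append)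
    then show False using max by fastforce
  qed
  then obtain i where i: "i \<le> k" "q = p ! i" using k by (auto simp: in_set_conv_nth less_Suc_eq_le)
  have neq: "p ! m = p ! n \<longleftrightarrow> m = n" if "m \<le> k" "n \<le> k" for m n
    using dist that k(1) by (simp add: nth_eq_iff_index_eq)
  then have "i \<noteq> k" "i \<noteq> j" using q(2) qj i(2) by metis+
  then have i': "i < k" "i \<noteq> j" using i by auto
  \<comment> \<open>Otherwise \<open>q\<close> has its two path neighbours and the last vertex as
    three distinct neighbours; \<open>i\<close> differs from \<open>j\<close>, so the successor of
    \<open>q\<close> on the path is not the last vertex.\<close>
  have "i = 0"
  proof (rule ccontr)
    assume "i \<noteq> 0"
    then obtain h where h: "i = Suc h" by (cases i) auto
    have "{q, p ! h} \<in> F" "{q, p ! Suc i} \<in> F" "{q, p ! k} \<in> F"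
      using edge[of h] edge[of i] i i' h f(1) q(1) by (simp_all add: insert_commute)
    moreover have "p ! h \<noteq> p ! Suc i" "p ! Suc i \<noteq> p ! k" "p ! h \<noteq> p ! k"
      using h i' j by (subst neq; simp)+
    ultimately show False using three by blast
  qed
  have "3 \<le> length p" using i' \<open>i = 0\<close> j k by simp
  moreover have "set (cycle_edges p) \<subseteq> F"
  proof
    fix g assume "g \<in> set (cycle_edges p)"
    then obtain m where m: "m < length p" "g = {p ! m, p ! (Suc m mod length p)}"
      by (auto simp: in_set_conv_nth cycle_edges_nth)
    then show "g \<in> F" using edge[of m] f(1) q(1) i \<open>i = 0\<close> k by (cases "m = k") auto
  qed
  moreover have "e = cycle_edges p ! 0"
    using ab p k by (subst cycle_edges_nth) (auto simp: P_def)
  then have "e \<in> set (cycle_edges p)" using k by simp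
  ultimately show thesis using that dist by (auto simp: is_cycle_def)
qed

lemma half_struct_if_extreme:
  fixes E :: "'v::finite set set"
  assumes simple: "simple_graph E" and ext: "x extreme_point_of fractional_matchings E"
  shows "half_struct E x"
proof -
  have x: "x \<in> fractional_matchings E" using ext by (simp add: extreme_point_of_def)
  define F where "F = {e \<in> E. x $ e \<noteq> 0 \<and> x $ e \<noteq> 1}"
  note deg = extreme_fractional_degree[OF simple ext, folded F_def]
  have half: "x $ e = 1/2" if "e \<in> F" for e
  proof -
    \<comment> \<open>Scaling all deviations from one half keeps saturated loads: at a saturated
      vertex with fractional edges there are exactly two of them, and their values sum to 1.\<close>
    define d :: "real^('v set)" where "d = (\<chi> e. if e \<in> F then x $ e - 1/2 else 0)"
    have "d = 0"
    proof (rule extreme_perturbation[OF ext])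
      show "x $ e \<noteq> 0" if "d $ e \<noteq> 0" for e using that by (auto simp: d_def F_def split: if_splits)
      fix v assume v: "load E x v = 1"
      have inc: "incident E v \<inter> F = {f \<in> F. v \<in> f}" by (auto simp: incident_def F_def)
      show "load E d v = 0"
      proof (cases "{f \<in> F. v \<in> f} = {}")
        case True
        then show ?thesis unfolding load_def d_def using inc
          by (intro sum.neutral) auto
      next
        case False
        then obtain e where e: "e \<in> F" "v \<in> e" by blast
        have "0 < x $ e" using e fm_nonneg[OF x, of e] by (auto simp: F_def)
        have zero: "x $ f = 0" if f: "f \<in> incident E v - F" for f
        proof (rule ccontr)
          assume "x $ f \<noteq> 0"
          then have "x $ f = 1" using f by (auto simp: F_def incident_def)
          moreover have "(\<Sum>g\<in>{e, f}. x $ g) \<le> load E x v"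
            using e f by (intro sum_le_load[OF x]) (auto simp: incident_def F_def)
          moreover have "e \<noteq> f" using e f by auto
          ultimately show False using v \<open>0 < x $ e\<close> by simp
        qed
        have "load E d v = (\<Sum>f\<in>{f \<in> F. v \<in> f}. x $ f - 1/2)"
          unfolding load_def inc[symmetric] by (intro sum.mono_neutral_cong_right) (auto simp: d_def)
        also have "\<dots> = (\<Sum>f\<in>{f \<in> F. v \<in> f}. x $ f) - 1"
          using deg(1)[OF e] by (simp add: sum_subtractf)
        also have "(\<Sum>f\<in>{f \<in> F. v \<in> f}. x $ f) = load E x v"
          unfolding load_def inc[symmetric] using zero by (intro sum.mono_neutral_left) auto
        finally show ?thesis using v by simp
      qed
    qed
    then show ?thesis using that by (auto simp: d_def vec_eq_iff split: if_splits)
  qed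
  have "e \<in> \<Union> (half_cycles E x)" if e: "e \<in> F" for e
  proof -
    have "simple_graph F" using simple by (auto simp: simple_graph_def F_def)
    moreover have "card {f \<in> F. v \<in> f} = 2" if "v \<in> \<Union> F" for v using that deg(1) by blast
    ultimately obtain c where c: "is_cycle F c" "e \<in> set (cycle_edges c)"
      using two_regular_cycle e by metis
    then have c': "3 \<le> length c" "distinct c" "set (cycle_edges c) \<subseteq> F" by (auto simp: is_cycle_def)
    have cE: "is_cycle E c" using c(1) by (auto simp: is_cycle_def F_def)
    have "odd (length c)"
    proof
      assume even: "even (length c)"
      \<comment> \<open>On an even cycle alternating signs cancel at every vertex, including where
        the cycle closes, so extremality would force this nonzero vector to vanish.\<close>
      define d :: "real^('v set)" where
        "d = (\<chi> e. if e \<in> set (cycle_edges c)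
                     then if \<exists>i<length c. even i \<and> e = cycle_edges c ! i then 1 else - 1 else 0)"
      have d: "d $ (cycle_edges c ! i) = (if even i then 1 else - 1)" if "i < length c" for i
        using that cycle_edges_inj[OF c'(1,2) that] by (auto simp: d_def)
      have "d = 0"
      proof (rule extreme_perturbation[OF ext])
        show "x $ e \<noteq> 0" if "d $ e \<noteq> 0" for e
        proof -
          have "e \<in> set (cycle_edges c)" using that by (auto simp: d_def split: if_splits)
          then show ?thesis using c'(3) by (auto simp: F_def)
        qed
        fix v
        show "load E d v = 0"
        proof (cases "v \<in> set c")
          case True
          then obtain i where i: "i < length c" "v = c ! (Suc i mod length c)"
            by (rule cycle_vertex_conv)
          have "load E d v = d $ (cycle_edges c ! i) + d $ (cycle_edges c ! (Suc i mod length c))"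
            unfolding i(2) by (rule load_cycle[OF cE i(1) refl]) (auto simp: d_def)
          moreover have "odd i" if "Suc i = length c" using even that by (metis even_Suc)
          then have "d $ (cycle_edges c ! i) + d $ (cycle_edges c ! (Suc i mod length c)) = 0"
            unfolding d[OF i(1)] d[OF Suc_mod_less[OF i(1)]] using i(1) by (auto simp: mod_Suc)
          ultimately show ?thesis by simp
        next
          case False
          then have "d $ e = 0" if "e \<in> incident E v" for e
            using that Union_cycle_edges[of c] by (auto simp: d_def incident_def)
          then show ?thesis by (simp add: load_def)
        qed
      qed
      moreover have "0 < length c" using c'(1) by linarith
      ultimately show False using d[of 0] by simp
    qed
    then have "set (cycle_edges c) \<in> half_cycles E x"
      using cE half c'(3) by (auto simp: half_cycles_def)
    then show ?thesis using c(2) by blast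
  qed
  then show ?thesis using x by (auto simp: half_struct_def F_def)
qed

subsection \<open>Rounding and complementing\<close>

lemma half_struct_cases:
  assumes "half_struct E x"
  shows "x $ e = 0 \<or> x $ e = 1 \<or> e \<in> \<Union> (half_cycles E x)"
  using assms by (cases "e \<in> E") (auto simp: half_struct_def fm_iff)

text \<open>Makes the parity of a cycle a property of its edge set, so the traversal picked by
  choice is odd like the cycle that witnesses membership in \<open>half_cycles\<close>.\<close>

lemma length_cycle_eq_card:
  assumes "is_cycle E c"
  shows "length c = card (set (cycle_edges c))"
proof -
  have "distinct (cycle_edges c)"
    using assms cycle_edges_inj[of c] unfolding distinct_conv_nth is_cycle_def by auto
  then show ?thesis by (simp add: distinct_card)
qed

lemma traversal:
  assumes "C \<in> half_cycles E x" "v \<in> \<Union> C" "c = traversal C v"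
  shows "is_cycle E c" "hd c = v" "set (cycle_edges c) = C" "odd (length c)"
proof -
  have c: "is_cycle C c \<and> hd c = v \<and> set (cycle_edges c) = C"
    unfolding assms(3) traversal_def by (rule someI_ex[OF traversal_ex[OF assms(1,2)]])
  obtain d where d: "is_cycle E d" "odd (length d)" "C = set (cycle_edges d)"
    using assms(1) by (auto simp: half_cycles_def)
  show "hd c = v" "set (cycle_edges c) = C" using c by auto
  show "is_cycle E c" using c d by (auto simp: is_cycle_def)
  show "odd (length c)"
    using d length_cycle_eq_card[OF d(1)] length_cycle_eq_card[of C c] c by simp
qed

lemma alternate_round_nth:
  assumes "is_cycle E c" "c = traversal C v" "i < length c"
  shows "alternate_round C v x $ (cycle_edges c ! i) = (if even i then 0 else 1)"
proof -
  have "cycle_edges c ! i = cycle_edges c ! j \<longleftrightarrow> i = j" if "j < length c" for j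
    using assms(1,3) that cycle_edges_inj[of c i j] by (auto simp: is_cycle_def)
  then show ?thesis
    using assms(3) unfolding alternate_round_def assms(2)[symmetric] Let_def by auto
qed

lemma alternate_round_other:
  assumes "C \<in> half_cycles E x" "v \<in> \<Union> C" "e \<notin> C"
  shows "alternate_round C v x $ e = x $ e"
proof -
  have "set (cycle_edges (traversal C v)) = C" by (rule traversal(3)[OF assms(1,2) refl])
  then have "e \<noteq> cycle_edges (traversal C v) ! i" if "i < length (traversal C v)" for i
    using assms(3) that by (metis length_cycle_edges nth_mem)
  then show ?thesis by (auto simp: alternate_round_def Let_def)
qed

lemma alternate_round_on:
  assumes "C \<in> half_cycles E x" "v \<in> \<Union> C" "e \<in> C"
  shows "alternate_round C v x $ e = 0 \<or> alternate_round C v x $ e = 1"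
proof -
  note c = traversal[OF assms(1,2) refl]
  obtain i where "i < length (traversal C v)" "e = cycle_edges (traversal C v) ! i"
    using assms(3) c(3) by (metis in_set_conv_nth length_cycle_edges)
  then show ?thesis using alternate_round_nth[OF c(1) refl] by auto
qed

text \<open>Consecutive positions have opposite parity and contribute 1 together. Only at
  \<open>v\<close> do the first and last positions meet; in an odd cycle both are even, so both
  edges get 0.\<close>

lemma alternate_round_load:
  assumes x: "x \<in> fractional_matchings E" and C: "C \<in> half_cycles E x" and v: "v \<in> \<Union> C"
  shows "load E (alternate_round C v x) u = (if u = v then 0 else load E x u)"
proof -
  define c where "c = traversal C v"
  define x' where "x' = alternate_round C v x"
  note c = traversal[OF C v c_def]
  note nth = alternate_round_nth[OF c(1) c_def, of _ x, folded x'_def]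
  note other = alternate_round_other[OF C v, folded x'_def]
  have c': "3 \<le> length c" "distinct c" using c(1) by (auto simp: is_cycle_def)
  then have hd: "c ! 0 = v" using c(2) by (cases c) auto
  have setc: "\<Union> C = set c" using c(3) Union_cycle_edges[of c] by simp
  have "load E x' u = (if u = v then 0 else load E x u)"
  proof (cases "u \<in> \<Union> C")
    case True
    then obtain i where i: "i < length c" "u = c ! (Suc i mod length c)"
      using setc cycle_vertex_conv by metis
    note j = Suc_mod_less[OF i(1)]
    have "0 < length c" using c'(1) by linarith
    then have "u = v \<longleftrightarrow> Suc i mod length c = 0"
      unfolding i(2) hd[symmetric] by (rule nth_eq_iff_index_eq[OF c'(2) j])
    moreover have "odd (length c)" by (rule c(4))
    moreover have "load E x' u = x' $ (cycle_edges c ! i) + x' $ (cycle_edges c ! (Suc i mod length c))"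
      unfolding i(2) using half_cycle_edge[OF x C True] c(3) other i(2)
      by (intro load_cycle[OF c(1) i(1) refl]) metis
    moreover have "even i" if "Suc i = length c" using that c(4) by (metis even_Suc)
    ultimately show ?thesis
      using half_cycle_load[OF x C True] nth[OF i(1)] nth[OF j] i(1)
      by (cases "Suc i = length c") auto
  next
    case False
    then have "load E x' u = load E x u"
      unfolding load_def using other by (intro sum.cong) (auto simp: incident_def)
    then show ?thesis using False v by auto
  qed
  then show ?thesis by (simp add: x'_def)
qed

lemma half_cycle_nonempty:
  assumes "C \<in> half_cycles E x"
  obtains e where "e \<in> C" "x $ e = 1/2"
proof -
  obtain c where c: "is_cycle E c" "C = set (cycle_edges c)" "\<And>e. e \<in> C \<Longrightarrow> e \<in> E \<and> x $ e = 1/2"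
    using assms by (rule half_cycleE) blast
  then have "c \<noteq> []" by (auto simp: is_cycle_def)
  then have "cycle_edges c ! 0 \<in> C" using c(2) by simp
  then show thesis using that c(3) by blast
qed

lemma half_cycle_val: "C \<in> half_cycles E x \<Longrightarrow> e \<in> C \<Longrightarrow> e \<in> E \<and> x $ e = 1/2"
  by (rule half_cycleE) auto

text \<open>The rounded edges are integral, so no remaining cycle uses them; the other half cycles
  share no vertex, hence no edge, with \<open>C\<close> and keep their values.\<close>

lemma alternate_round_half_cycles:
  assumes simple: "simple_graph E" and x: "x \<in> fractional_matchings E"
    and C: "C \<in> half_cycles E x" and v: "v \<in> \<Union> C"
  shows "half_cycles E (alternate_round C v x) = half_cycles E x - {C}"
proof (intro equalityI subsetI)
  let ?x' = "alternate_round C v x"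
  fix D assume D: "D \<in> half_cycles E ?x'"
  have out: "e \<notin> C" if "e \<in> D" for e
    using half_cycle_val[OF D that] alternate_round_on[OF C v, of e] by auto
  then have "x $ e = 1/2" if "e \<in> D" for e
    using half_cycle_val[OF D that] alternate_round_other[OF C v, of e] that by auto
  then have "D \<in> half_cycles E x" using D by (auto simp: half_cycles_def)
  moreover have "D \<noteq> C" using half_cycle_nonempty[OF D] out by metis
  ultimately show "D \<in> half_cycles E x - {C}" by simp
next
  let ?x' = "alternate_round C v x"
  fix D assume D: "D \<in> half_cycles E x - {C}"
  have "?x' $ e = 1/2" if e: "e \<in> D" for e
  proof -
    have "e \<in> E" "x $ e = 1/2" using half_cycle_val[of D E x e] D e by auto
    then obtain u where "u \<in> e" using simple by (fastforce simp: simple_graph_def card_2_iff)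
    then have "e \<notin> C" using half_cycles_disjoint[OF x C, of D u] D e by auto
    then show ?thesis using alternate_round_other[OF C v] \<open>x $ e = 1/2\<close> by simp
  qed
  then show "D \<in> half_cycles E ?x'" using D by (auto simp: half_cycles_def)
qed

lemma alternate_round_half_struct:
  assumes simple: "simple_graph E" and x: "half_struct E x"
    and C: "C \<in> half_cycles E x" and v: "v \<in> \<Union> C"
  shows "half_struct E (alternate_round C v x)"
proof -
  let ?x' = "alternate_round C v x"
  have fm: "x \<in> fractional_matchings E" using x by (simp add: half_struct_def)
  note on = alternate_round_on[OF C v] and other = alternate_round_other[OF C v]
  have "C \<subseteq> E" using half_cycle_val[OF C] by blast
  have "?x' \<in> fractional_matchings E"
    unfolding fm_iff
  proof (intro conjI allI impI ballI)
    fix e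
    show "0 \<le> ?x' $ e" using on[of e] other[of e] fm_nonneg[OF fm, of e] by (cases "e \<in> C") auto
    assume "e \<notin> E"
    then show "?x' $ e = 0" using \<open>C \<subseteq> E\<close> other[of e] fm by (auto simp: fm_iff)
  next
    fix u
    show "load E ?x' u \<le> 1" using fm by (simp add: alternate_round_load[OF fm C v] fm_iff)
  qed
  moreover have "?x' $ e = 0 \<or> ?x' $ e = 1 \<or> e \<in> \<Union> (half_cycles E ?x')" for e
    unfolding alternate_round_half_cycles[OF simple fm C v]
    using half_struct_cases[OF x, of e] on[of e] other[of e] by (cases "e \<in> C") auto
  ultimately show ?thesis by (simp add: half_struct_def)
qed

section \<open>Complementing along a path\<close>

lemma path_edges_inj:
  assumes "distinct p" "Suc i < length p" "Suc j < length p" "path_edges p ! i = path_edges p ! j"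
  shows "i = j"
  using assms by (auto simp: path_edges_nth doubleton_eq_iff nth_eq_iff_index_eq)

text \<open>One formula for inner and end vertices: the bound on \<open>k\<close> drops the missing
  edge at an end.\<close>

lemma path_incident:
  assumes "distinct p" "i < length p"
  shows "{e \<in> set (path_edges p). p ! i \<in> e} =
           {path_edges p ! k | k. Suc k < length p \<and> (k = i \<or> Suc k = i)}"
proof (intro equalityI subsetI)
  fix e assume "e \<in> {e \<in> set (path_edges p). p ! i \<in> e}"
  then obtain k where "k < length (path_edges p)" "e = path_edges p ! k" "p ! i \<in> e"
    by (auto simp: in_set_conv_nth)
  then have k: "Suc k < length p" "e = path_edges p ! k" "p ! i \<in> {p ! k, p ! Suc k}"
    using path_edges_nth[of k p] by auto
  then show "e \<in> {path_edges p ! k | k. Suc k < length p \<and> (k = i \<or> Suc k = i)}"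
    using assms by (auto simp: nth_eq_iff_index_eq)
next
  fix e assume "e \<in> {path_edges p ! k | k. Suc k < length p \<and> (k = i \<or> Suc k = i)}"
  then obtain k where k: "e = path_edges p ! k" "Suc k < length p" "k = i \<or> Suc k = i" by auto
  then have "path_edges p ! k \<in> set (path_edges p)" by (intro nth_mem) simp
  then show "e \<in> {e \<in> set (path_edges p). p ! i \<in> e}" using k by (auto simp: path_edges_nth)
qed

text \<open>Each path edge at a vertex changes its load by one minus twice the old value; the
  changes +1 and -1 cancel at inner vertices. The parity of the length is left open, so the change
  at the end is expressed by the last edge.\<close>

lemma flip_load:
  fixes x :: "real^('v::finite set)"
  assumes p: "is_path E p" "2 \<le> length p"
    and val: "\<And>i. Suc i < length p \<Longrightarrow> x $ (path_edges p ! i) = (if even i then 0 else 1)"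
  defines "x' \<equiv> complement_on (set (path_edges p)) x"
  shows "load E x' (hd p) = load E x (hd p) + 1"
    and "u \<noteq> hd p \<Longrightarrow> u \<noteq> last p \<Longrightarrow> load E x' u = load E x u"
    and "load E x' (last p) = load E x (last p) + 1 - 2 * x $ last (path_edges p)"
proof -
  have dist: "distinct p" and pE: "set (path_edges p) \<subseteq> E" and ne: "p \<noteq> []"
    using p by (auto simp: is_path_def)
  have off: "x' $ e = x $ e" if "e \<notin> set (path_edges p)" for e using that by (simp add: x'_def complement_on_def)
  have on: "x' $ e = 1 - x $ e" if "e \<in> set (path_edges p)" for e using that by (simp add: x'_def complement_on_def)
  have ld: "load E x' u = load E x u + (\<Sum>e | e \<in> set (path_edges p) \<and> u \<in> e. 1 - 2 * x $ e)" for u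
  proof -
    let ?A = "{e \<in> set (path_edges p). u \<in> e}"
    have "load E x' u = load E x u - (\<Sum>e\<in>?A. x $ e) + (\<Sum>e\<in>?A. x' $ e)"
      using off pE by (intro load_cong_off) (auto simp: incident_def)
    also have "(\<Sum>e\<in>?A. x' $ e) = (\<Sum>e\<in>?A. 1 - x $ e)" using on by (intro sum.cong) auto
    finally show ?thesis by (simp add: sum_subtractf sum_distrib_left[symmetric])
  qed
  have inc0: "{e \<in> set (path_edges p). p ! 0 \<in> e} = {path_edges p ! 0}"
  proof -
    have "0 < length p" using p(2) by linarith
    then show ?thesis unfolding path_incident[OF dist \<open>0 < length p\<close>] using p(2) by auto
  qed
  have hd: "hd p = p ! 0" and last: "last p = p ! (length p - 1)"
    using ne by (simp_all add: hd_conv_nth last_conv_nth)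
  show "load E x' (hd p) = load E x (hd p) + 1"
    using val[of 0] p(2) unfolding ld hd inc0 by simp
  obtain m where m: "length p = Suc (Suc m)" using p(2) by (metis Suc_le_D numeral_2_eq_2 Suc_le_mono)
  have incl: "{e \<in> set (path_edges p). p ! Suc m \<in> e} = {path_edges p ! m}"
  proof -
    have "Suc m < length p" using m by simp
    then show ?thesis unfolding path_incident[OF dist \<open>Suc m < length p\<close>] using m by auto
  qed
  have "last (path_edges p) = path_edges p ! m"
    using m by (subst last_conv_nth) (auto simp flip: length_greater_0_conv)
  then show "load E x' (last p) = load E x (last p) + 1 - 2 * x $ last (path_edges p)"
    unfolding ld last m using incl by simp
  assume u: "u \<noteq> hd p" "u \<noteq> last p"
  show "load E x' u = load E x u"
  proof (cases "u \<in> set p")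
    case True
    then obtain i where i: "i < length p" "u = p ! i" by (auto simp: in_set_conv_nth)
    then have "i \<noteq> 0" "i \<noteq> length p - 1" using u hd last by metis+
    then obtain k where k: "i = Suc k" "Suc (Suc k) < length p" using i(1) by (cases i) auto
    have "path_edges p ! k \<noteq> path_edges p ! Suc k"
      using path_edges_inj[OF dist, of k "Suc k"] k(2) by auto
    moreover have "{e \<in> set (path_edges p). u \<in> e} = {path_edges p ! k, path_edges p ! Suc k}"
      unfolding i(2) path_incident[OF dist i(1)] using k by auto
    ultimately show ?thesis unfolding ld using val[of k] val[of "Suc k"] k(2) by simp
  next
    case False
    then have none: "{e \<in> set (path_edges p). u \<in> e} = {}" using Union_path_edges[of p] by blast
    show ?thesis unfolding ld none by simp
  qed
qed

lemma complement_half_cycles: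
  assumes "\<And>e. e \<in> F \<Longrightarrow> x $ e = 0 \<or> x $ e = 1"
  shows "half_cycles E (complement_on F x) = half_cycles E x"
proof -
  have "complement_on F x $ e = 1/2 \<longleftrightarrow> x $ e = 1/2" for e
    using assms[of e] by (auto simp: complement_on_def)
  then show ?thesis by (simp add: half_cycles_def)
qed

text \<open>Only the ends can be overloaded: the first vertex gains 1 from load 0, the last one
  either starts from load 0 or loses its matching edge.\<close>

lemma flip_half_struct:
  assumes x: "half_struct E x" and p: "is_path E p" "2 \<le> length p"
    and val: "\<And>i. Suc i < length p \<Longrightarrow> x $ (path_edges p ! i) = (if even i then 0 else 1)"
    and hd: "load E x (hd p) = 0"
    and last: "load E x (last p) = 0 \<or> x $ last (path_edges p) = 1"
  shows "half_struct E (complement_on (set (path_edges p)) x)"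
    and "half_cycles E (complement_on (set (path_edges p)) x) = half_cycles E x"
proof -
  let ?x' = "complement_on (set (path_edges p)) x"
  have fm: "x \<in> fractional_matchings E" using x by (simp add: half_struct_def)
  have val': "x $ e = 0 \<or> x $ e = 1" if "e \<in> set (path_edges p)" for e
    using that val by (auto simp: in_set_conv_nth less_diff_conv split: if_splits)
  show hc: "half_cycles E ?x' = half_cycles E x" by (rule complement_half_cycles[OF val'])
  have pE: "set (path_edges p) \<subseteq> E" using p by (auto simp: is_path_def)
  have "?x' \<in> fractional_matchings E" unfolding fm_iff
  proof (intro conjI allI impI ballI)
    fix e assume "e \<notin> E"
    then show "?x' $ e = 0" using pE fm by (auto simp: complement_on_def fm_iff)
  next
    fix e
    show "0 \<le> ?x' $ e" using val'[of e] fm_nonneg[OF fm, of e] by (auto simp: complement_on_def)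
  next
    fix u
    note fl = flip_load[OF p val]
    have 0: "0 \<le> x $ last (path_edges p)" by (rule fm_nonneg[OF fm])
    have 1: "load E x u \<le> 1" for u using fm by (simp add: fm_iff)
    show "load E ?x' u \<le> 1"
    proof (cases "u = hd p")
      case False
      then show ?thesis using fl(2)[of u] fl(3) last 0 1[of u] by (cases "u = last p") auto
    qed (use fl(1) hd in simp)
  qed
  moreover have "?x' $ e = 0 \<or> ?x' $ e = 1 \<or> e \<in> \<Union> (half_cycles E ?x')" for e
    unfolding hc using half_struct_cases[OF x, of e] val'[of e] by (auto simp: complement_on_def)
  ultimately show "half_struct E ?x'" by (simp add: half_struct_def)
qed

text \<open>\<open>z\<close> arises from \<open>x\<close> by alternate rounding on every half cycle, and \<open>S\<close> collects the vertices
  at which the rounding took place.\<close>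

definition fully_rounded ::
    "'v::finite set set \<Rightarrow> real^('v set) \<Rightarrow> real^('v set) \<Rightarrow> 'v set \<Rightarrow> bool" where
  "fully_rounded E x z S \<longleftrightarrow>
     half_struct E z \<and> half_cycles E z = {} \<and>
     (\<forall>e. e \<notin> \<Union> (half_cycles E x) \<longrightarrow> z $ e = x $ e) \<and>
     S \<subseteq> \<Union> (\<Union> (half_cycles E x)) \<and> card S = card (half_cycles E x) \<and>
     (\<forall>C u v. C \<in> half_cycles E x \<longrightarrow> u \<in> S \<longrightarrow> v \<in> S \<longrightarrow> u \<in> \<Union> C \<longrightarrow> v \<in> \<Union> C \<longrightarrow> u = v) \<and>
     (\<forall>u. load E z u = (if u \<in> S then 0 else load E x u))"

lemma fully_roundedD:
  assumes "fully_rounded E x z S"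
  shows "half_struct E z" "half_cycles E z = {}" "S \<subseteq> \<Union> (\<Union> (half_cycles E x))"
    "card S = card (half_cycles E x)"
    and "e \<notin> \<Union> (half_cycles E x) \<Longrightarrow> z $ e = x $ e"
    and "C \<in> half_cycles E x \<Longrightarrow> u \<in> S \<Longrightarrow> v \<in> S \<Longrightarrow> u \<in> \<Union> C \<Longrightarrow> v \<in> \<Union> C \<Longrightarrow> u = v"
    and "load E z u = (if u \<in> S then 0 else load E x u)"
proof -
  note a = assms[unfolded fully_rounded_def]
  show "half_struct E z" using a by (elim conjE)
  show "half_cycles E z = {}" using a by (elim conjE)
  show "S \<subseteq> \<Union> (\<Union> (half_cycles E x))" using a by (elim conjE)
  show "card S = card (half_cycles E x)" using a by (elim conjE)
  show "z $ e = x $ e" if "e \<notin> \<Union> (half_cycles E x)" using a that by (elim conjE) simp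
  show "u = v" if "C \<in> half_cycles E x" "u \<in> S" "v \<in> S" "u \<in> \<Union> C" "v \<in> \<Union> C"
  proof -
    have "\<forall>C u v. C \<in> half_cycles E x \<longrightarrow> u \<in> S \<longrightarrow> v \<in> S \<longrightarrow> u \<in> \<Union> C \<longrightarrow> v \<in> \<Union> C \<longrightarrow> u = v"
      using a by (elim conjE)
    from this[rule_format, OF that] show ?thesis .
  qed
  show "load E z u = (if u \<in> S then 0 else load E x u)" using a by (elim conjE) simp
qed

text \<open>Induction on the number of half cycles, rounding one at any of its vertices.
  Disjointness keeps the later rounding vertices off this cycle, which gives exactly one vertex of
  \<open>S\<close> per cycle.\<close>

lemma fully_rounded_exists:
  assumes simple: "simple_graph E" and "half_struct E x"
  shows "\<exists>z S. fully_rounded E x z S"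
  using assms(2)
proof (induction "card (half_cycles E x)" arbitrary: x)
  case 0
  then have "half_cycles E x = {}" by simp
  then show ?case using 0 by (intro exI[of _ x] exI[of _ "{}"]) (auto simp: fully_rounded_def)
next
  case (Suc n)
  then obtain C where C: "C \<in> half_cycles E x" by (metis card.empty equals0I nat.distinct(1))
  have fm: "x \<in> fractional_matchings E" using Suc.prems by (simp add: half_struct_def)
  obtain e where e: "e \<in> C" "x $ e = 1/2" by (rule half_cycle_nonempty[OF C])
  then have "e \<in> E" using half_cycle_val[OF C] by blast
  then obtain v where "v \<in> e" using simple by (fastforce simp: simple_graph_def card_2_iff)
  then have v: "v \<in> \<Union> C" using e by blast
  define z where "z = alternate_round C v x"
  have z: "half_struct E z" "half_cycles E z = half_cycles E x - {C}"
    "\<And>e. e \<notin> C \<Longrightarrow> z $ e = x $ e" "\<And>u. load E z u = (if u = v then 0 else load E x u)"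
    unfolding z_def using alternate_round_half_struct[OF simple Suc.prems C v]
      alternate_round_half_cycles[OF simple fm C v] alternate_round_other[OF C v]
      alternate_round_load[OF fm C v] by auto
  have "n = card (half_cycles E z)" using Suc.hyps(2) C z(2) by simp
  from Suc.hyps(1)[OF this z(1)] obtain x' S where "fully_rounded E z x' S" by blast
  note S = fully_roundedD[OF this]
  have SC: "S \<inter> \<Union> C = {}"
  proof (rule ccontr)
    assume "S \<inter> \<Union> C \<noteq> {}"
    then obtain u where u: "u \<in> S" "u \<in> \<Union> C" by auto
    then have "u \<in> \<Union> (\<Union> (half_cycles E x - {C}))" using S(3) unfolding z(2) by (rule_tac subsetD)
    then obtain D where "D \<in> half_cycles E x - {C}" "u \<in> \<Union> D" by auto
    then show False using half_cycles_disjoint[OF fm C _ u(2), of D] by simp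
  qed
  have dv: "v \<notin> \<Union> D" if "D \<in> half_cycles E x - {C}" for D
    using that half_cycles_disjoint[OF fm C _ v, of D] by auto
  have uniq: "p = q" if D: "D \<in> half_cycles E x" and pq: "p \<in> insert v S" "q \<in> insert v S" "p \<in> \<Union> D" "q \<in> \<Union> D"
    for D p q
  proof (cases "D = C")
    case True
    then show ?thesis using SC pq by blast
  next
    case False
    then have D': "D \<in> half_cycles E z" "v \<notin> \<Union> D" using D z(2) dv by auto
    then have "p \<in> S" "q \<in> S" using pq by auto
    from S(6)[OF D'(1) this pq(3,4)] show ?thesis .
  qed
  have "fully_rounded E x x' (insert v S)" unfolding fully_rounded_def
  proof (intro conjI)
    show "half_struct E x'" by (rule S(1))
    show "half_cycles E x' = {}" by (rule S(2))
    show "\<forall>e. e \<notin> \<Union> (half_cycles E x) \<longrightarrow> x' $ e = x $ e"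
    proof (intro allI impI)
      fix e assume e: "e \<notin> \<Union> (half_cycles E x)"
      then have "e \<notin> \<Union> (half_cycles E z)" "e \<notin> C" using z(2) C by auto
      then show "x' $ e = x $ e" using S(5)[of e] z(3)[of e] by simp
    qed
    have "\<Union> (\<Union> (half_cycles E z)) \<subseteq> \<Union> (\<Union> (half_cycles E x))"
      unfolding z(2) by (intro Union_mono) auto
    moreover have "v \<in> \<Union> (\<Union> (half_cycles E x))" using v C by blast
    ultimately show "insert v S \<subseteq> \<Union> (\<Union> (half_cycles E x))"
      using S(3) by (simp only: insert_subset subset_trans simp_thms)
    have "v \<notin> S" using SC v by blast
    then show "card (insert v S) = card (half_cycles E x)"
      using S(4) \<open>n = card (half_cycles E z)\<close> Suc.hyps(2) by simp
    show "\<forall>C u q. C \<in> half_cycles E x \<longrightarrow> u \<in> insert v S \<longrightarrow> q \<in> insert v S \<longrightarrow>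
            u \<in> \<Union> C \<longrightarrow> q \<in> \<Union> C \<longrightarrow> u = q"
      using uniq by blast
    show "\<forall>u. load E x' u = (if u \<in> insert v S then 0 else load E x u)"
      using S(7) z(4) by simp
  qed
  then show ?case by blast
qed

subsection \<open>Improving configurations\<close>

text \<open>Reduces each improvement claim to two invariants that can be checked edge by edge and
  vertex by vertex.\<close>

lemma basic_if_complementary:
  assumes "simple_graph E" "half_struct E x" "y \<in> fractional_covers E w" "complementary E w x y"
  shows "basic_max_weight_fm E w x"
  using extreme_if_half_struct[OF assms(1,2)] max_weight_if_complementary[OF assms(1) _ assms(3,4)] assms(2)
  by (simp add: basic_max_weight_fm_def half_struct_def)

text \<open>Rounding does not enlarge the support, because cycle edges were already positive, and
  only \<open>v\<close> loses saturation, which slackness permits where \<open>y\<close> is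
  0.\<close>

lemma config_vertex_improves:
  assumes simple: "simple_graph E" and x: "half_struct E x" and y: "y \<in> fractional_covers E w"
    and comp: "complementary E w x y" and conf: "config_vertex E x y C v"
  shows "basic_max_weight_fm E w (alternate_round C v x)"
    and "half_cycles E (alternate_round C v x) \<subset> half_cycles E x"
proof -
  have C: "C \<in> half_cycles E x" and v: "v \<in> \<Union> C" and yv: "y $ v = 0"
    using conf by (simp_all only: config_vertex_def)
  have fm: "x \<in> fractional_matchings E" using x by (simp add: half_struct_def)
  show "half_cycles E (alternate_round C v x) \<subset> half_cycles E x"
    unfolding alternate_round_half_cycles[OF simple fm C v] using C by blast
  have supp: "x $ e \<noteq> 0" if "alternate_round C v x $ e \<noteq> 0" for e
    using that half_cycle_val[OF C, of e] alternate_round_other[OF C v, of e] by (cases "e \<in> C") auto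
  have "complementary E w (alternate_round C v x) y"
    using comp supp yv unfolding complementary_def alternate_round_load[OF fm C v] by auto
  then show "basic_max_weight_fm E w (alternate_round C v x)"
    by (intro basic_if_complementary[OF simple alternate_round_half_struct[OF simple x C v] y])
qed

text \<open>An inner vertex of the path meets an edge of value 1 and so lies on no half cycle. A
  path edge in a half cycle would therefore join the two ends of the path directly, within
  \<open>C\<close>. The first edge has value 0 because \<open>hd p\<close> is saturated by half
  edges; alternation fixes the rest.\<close>

lemma alternating_path_values:
  assumes x: "half_struct E x" and C: "C \<in> half_cycles E x" and hd: "hd p \<in> \<Union> C"
    and last: "last p \<notin> \<Union> C" and p: "is_path E p" and alt: "alternating (unit_edges E x) p"
    and i: "Suc i < length p"
  shows "path_edges p ! i \<notin> \<Union> (half_cycles E x)"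
    and "x $ (path_edges p ! i) = (if even i then 0 else 1)"
proof -
  let ?M = "unit_edges E x"
  have fm: "x \<in> fractional_matchings E" using x by (simp add: half_struct_def)
  have ne: "p \<noteq> []" and pE: "set (path_edges p) \<subseteq> E" using p by (auto simp: is_path_def)
  have hd0: "hd p = p ! 0" and lastn: "last p = p ! (length p - 1)"
    using ne by (simp_all add: hd_conv_nth last_conv_nth)
  have inE: "path_edges p ! k \<in> E" if "Suc k < length p" for k
    using that pE nth_mem[of k "path_edges p"] by auto
  have mem: "p ! k \<in> path_edges p ! k" "p ! Suc k \<in> path_edges p ! k" if "Suc k < length p" for k
    using that by (simp_all add: path_edges_nth)
  have M_half: False if "e \<in> ?M" "v \<in> e" "v \<in> \<Union> H" "H \<in> half_cycles E x" for e v H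
    using half_cycle_edge[OF fm that(4,3), of e] half_cycle_val[OF that(4), of e] that(1,2)
    by (auto simp: unit_edges_def)
  have inner: "p ! Suc k \<notin> \<Union> H" if "Suc (Suc k) < length p" "H \<in> half_cycles E x" for k H
  proof
    assume *: "p ! Suc k \<in> \<Union> H"
    have "path_edges p ! k \<in> ?M \<or> path_edges p ! Suc k \<in> ?M"
      using alt that(1) unfolding alternating_def by (metis length_path_edges less_diff_conv Suc_eq_plus1)
    then show False using M_half[OF _ _ * that(2)] mem(2)[of k] mem(1)[of "Suc k"] that(1) by auto
  qed
  have notin: "path_edges p ! i \<notin> \<Union> (half_cycles E x)" if i: "Suc i < length p" for i
  proof
    assume "path_edges p ! i \<in> \<Union> (half_cycles E x)"
    then obtain H where H: "H \<in> half_cycles E x" "path_edges p ! i \<in> H" by auto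
    then have v: "p ! i \<in> \<Union> H" "p ! Suc i \<in> \<Union> H" using mem[OF i] by auto
    have "i = 0" using inner[OF _ H(1)] v(1) i by (cases i) auto
    moreover have "\<not> Suc (Suc i) < length p" using inner[OF _ H(1)] v(2) by auto
    ultimately have "hd p \<in> \<Union> H" "last p \<in> \<Union> H" using v i hd0 lastn by (auto simp: not_less le_less)
    moreover from this have "H = C" using half_cycles_disjoint[OF fm C H(1) hd] by simp
    ultimately show False using last by simp
  qed
  then show "path_edges p ! i \<notin> \<Union> (half_cycles E x)" using i by blast
  have 01: "x $ (path_edges p ! k) = 0 \<or> x $ (path_edges p ! k) = 1" if "Suc k < length p" for k
    using half_struct_cases[OF x] notin[OF that] by metis
  show "x $ (path_edges p ! i) = (if even i then 0 else 1)"
    using i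
  proof (induction i)
    case 0
    have "x $ (path_edges p ! 0) = 0"
      using half_cycle_edge[OF fm C hd inE[OF 0]] mem(1)[OF 0] notin[OF 0] C hd0 by auto
    then show ?case by simp
  next
    case (Suc k)
    have "path_edges p ! k \<in> ?M \<longleftrightarrow> path_edges p ! Suc k \<notin> ?M"
      using alt Suc.prems unfolding alternating_def by (simp add: less_diff_conv)
    moreover have "x $ (path_edges p ! k) = (if even k then 0 else 1)" using Suc by simp
    ultimately show ?case
      using 01[OF Suc.prems] inE[OF Suc.prems] inE[of k] Suc.prems
      by (auto simp: unit_edges_def split: if_splits)
  qed
qed

lemma load_exposed:
  assumes "half_struct E x" "exposed (unit_edges E x) v" "v \<notin> \<Union> (\<Union> (half_cycles E x))"
  shows "load E x v = 0"
  unfolding load_def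
proof (rule sum.neutral, rule ballI)
  fix e assume "e \<in> incident E v"
  then show "x $ e = 0"
    using assms half_struct_cases[OF assms(1), of e] by (auto simp: incident_def exposed_def unit_edges_def)
qed

lemma tight_path_edge:
  assumes "tight_path w y p" "e \<in> set (path_edges p)" "distinct p"
  shows "w e = (\<Sum>v\<in>e. y $ v)"
proof -
  obtain k where k: "Suc k < length p" "e = {p ! k, p ! Suc k}"
    using assms(2) by (auto simp: in_set_conv_nth path_edges_nth less_diff_conv)
  then show ?thesis using assms by (auto simp: tight_path_def nth_eq_iff_index_eq)
qed

lemma config_cycle_vertex_improves:
  assumes simple: "simple_graph E" and x: "half_struct E x" and y: "y \<in> fractional_covers E w"
    and comp: "complementary E w x y" and conf: "config_cycle_vertex E w x y C p"
  defines "x' \<equiv> complement_on (set (path_edges p)) (alternate_round C (hd p) x)"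
  shows "basic_max_weight_fm E w x'" and "half_cycles E x' \<subset> half_cycles E x"
proof -
  let ?M = "unit_edges E x"
  define x1 where "x1 = alternate_round C (hd p) x"
  have C: "C \<in> half_cycles E x" and p: "is_path E p" and hd: "hd p \<in> \<Union> C"
    and last: "last p \<notin> \<Union> (\<Union> (half_cycles E x))" and yl: "y $ last p = 0"
    and tight: "tight_path w y p" and valid: "valid_alt_path ?M p"
    using conf unfolding config_cycle_vertex_def by blast+
  have fm: "x \<in> fractional_matchings E" using x by (simp add: half_struct_def)
  have dist: "distinct p" and pne: "p \<noteq> []" using p by (auto simp: is_path_def)
  have hl: "hd p \<noteq> last p" and lC: "last p \<notin> \<Union> C" using hd last C by auto
  then have len: "2 \<le> length p" using pne by (cases p; cases "tl p") auto
  have alt: "alternating ?M p" using valid by (simp add: valid_alt_path_def)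
  note vals = alternating_path_values[OF x C hd lC p alt]
  note x1 = alternate_round_half_struct[OF simple x C hd, folded x1_def]
    alternate_round_half_cycles[OF simple fm C hd, folded x1_def]
    alternate_round_load[OF fm C hd, folded x1_def]
  have other: "x1 $ e = x $ e" if "e \<notin> C" for e
    using alternate_round_other[OF C hd that] by (simp add: x1_def)
  have val1: "x1 $ (path_edges p ! i) = (if even i then 0 else 1)" if "Suc i < length p" for i
    using vals[OF that] C other by auto
  \<comment> \<open>The use of validity: an exposed end off the half cycles has load 0, otherwise
    the last edge is a matching edge that complementing removes.\<close>
  have ld_last: "load E x1 (last p) = 0 \<or> x1 $ last (path_edges p) = 1"
  proof (cases "exposed ?M (last p)")
    case True
    then show ?thesis using load_exposed[OF x True last] hl x1(3) by simp
  next
    case False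
    then have "path_edges p \<noteq> []" "last (path_edges p) \<in> ?M" using valid by (auto simp: valid_alt_path_def)
    then have "x $ last (path_edges p) = 1" "last (path_edges p) \<in> set (path_edges p)"
      by (auto simp: unit_edges_def)
    moreover from this have "last (path_edges p) \<notin> C" using half_cycle_val[OF C] by fastforce
    ultimately show ?thesis using other by simp
  qed
  have ld_hd: "load E x1 (hd p) = 0" using x1(3) by simp
  note flip = flip_half_struct[OF x1(1) p len val1 ld_hd ld_last, folded x'_def[folded x1_def]]
    flip_load[OF p len val1, folded x'_def[folded x1_def]]
  show "half_cycles E x' \<subset> half_cycles E x" using flip(2) x1(2) C by auto
  have "complementary E w x' y"
    unfolding complementary_def
  proof (intro conjI ballI allI impI)
    fix e assume e: "e \<in> E" "x' $ e \<noteq> 0"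
    show "w e = (\<Sum>v\<in>e. y $ v)"
    proof (cases "e \<in> set (path_edges p)")
      case True
      then show ?thesis using tight_path_edge[OF tight _ dist] by simp
    next
      case False
      then have "x1 $ e \<noteq> 0" using e(2) by (simp add: x'_def x1_def complement_on_def)
      then have "x $ e \<noteq> 0" using half_cycle_val[OF C, of e] other[of e] by (cases "e \<in> C") auto
      then show ?thesis using comp e(1) by (simp add: complementary_def)
    qed
  next
    fix u assume u: "y $ u \<noteq> 0"
    then have "u \<noteq> last p" "load E x u = 1" using yl comp by (auto simp: complementary_def)
    then show "load E x' u = 1" using flip(3) flip(4)[of u] ld_hd x1(3) by (cases "u = hd p") auto
  qed
  then show "basic_max_weight_fm E w x'" by (intro basic_if_complementary[OF simple flip(1) y])
qed

lemma config_cycle_cycle_improves: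
  assumes simple: "simple_graph E" and x: "half_struct E x" and y: "y \<in> fractional_covers E w"
    and comp: "complementary E w x y" and conf: "config_cycle_cycle E w x y C D p"
  defines "x' \<equiv> complement_on (set (path_edges p))
                   (alternate_round D (last p) (alternate_round C (hd p) x))"
  shows "basic_max_weight_fm E w x'" and "half_cycles E x' \<subset> half_cycles E x"
proof -
  let ?M = "unit_edges E x"
  define x1 where "x1 = alternate_round C (hd p) x"
  define x2 where "x2 = alternate_round D (last p) x1"
  have C: "C \<in> half_cycles E x" and D: "D \<in> half_cycles E x" and CD: "C \<noteq> D"
    and p: "is_path E p" and hd: "hd p \<in> \<Union> C" and last: "last p \<in> \<Union> D"
    and tight: "tight_path w y p" and alt: "alternating ?M p"
    using conf by (simp_all only: config_cycle_cycle_def simp_thms)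
  have fm: "x \<in> fractional_matchings E" using x by (simp add: half_struct_def)
  have dist: "distinct p" and pne: "p \<noteq> []" using p by (auto simp: is_path_def)
  have lC: "last p \<notin> \<Union> C" using half_cycles_disjoint[OF fm C D _ last] CD by blast
  then have hl: "hd p \<noteq> last p" using hd by metis
  then have len: "2 \<le> length p" using pne by (cases p; cases "tl p") auto
  note vals = alternating_path_values[OF x C hd lC p alt]
  note x1 = alternate_round_half_struct[OF simple x C hd, folded x1_def]
    alternate_round_half_cycles[OF simple fm C hd, folded x1_def]
    alternate_round_load[OF fm C hd, folded x1_def]
  have fm1: "x1 \<in> fractional_matchings E" using x1(1) by (simp add: half_struct_def)
  have D1: "D \<in> half_cycles E x1" using x1(2) D CD by simp
  note x2 = alternate_round_half_struct[OF simple x1(1) D1 last, folded x2_def]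
    alternate_round_half_cycles[OF simple fm1 D1 last, folded x2_def]
    alternate_round_load[OF fm1 D1 last, folded x2_def]
  have other1: "x1 $ e = x $ e" if "e \<notin> C" for e
    using alternate_round_other[OF C hd that] by (simp add: x1_def)
  have other: "x2 $ e = x $ e" if "e \<notin> C" "e \<notin> D" for e
    using alternate_round_other[OF D1 last that(2)] other1[OF that(1)] by (simp add: x2_def)
  have val2: "x2 $ (path_edges p ! i) = (if even i then 0 else 1)" if "Suc i < length p" for i
  proof -
    have "path_edges p ! i \<notin> C" "path_edges p ! i \<notin> D" using vals(1)[OF that] C D by blast+
    then show ?thesis using vals(2)[OF that] other by simp
  qed
  have ld_hd: "load E x2 (hd p) = 0" and ld_last: "load E x2 (last p) = 0"
    using x1(3) x2(3) hl by simp_all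
  note flip = flip_half_struct[OF x2(1) p len val2 ld_hd disjI1[OF ld_last],
      folded x'_def[folded x1_def, folded x2_def]]
    flip_load[OF p len val2, folded x'_def[folded x1_def, folded x2_def]]
  show "half_cycles E x' \<subset> half_cycles E x" using flip(2) x2(2) x1(2) C by auto
  have fm': "x' \<in> fractional_matchings E" using flip(1) by (simp add: half_struct_def)
  have "last (path_edges p) = path_edges p ! (length p - 2)"
    using len by (subst last_conv_nth) (simp_all add: numeral_2_eq_2 flip: length_greater_0_conv)
  then have "x2 $ last (path_edges p) = 0 \<or> x2 $ last (path_edges p) = 1"
    using val2[of "length p - 2"] len by auto
  \<comment> \<open>The parity of the path is derived here: a last edge of value 1 would leave load
    -1, so its value is 0 and the new load is 1.\<close>
  moreover have "0 \<le> load E x' (last p)"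
    unfolding load_def using fm_nonneg[OF fm'] by (intro sum_nonneg) auto
  ultimately have ld'_last: "load E x' (last p) = 1" using flip(5) ld_last by auto
  have "complementary E w x' y"
    unfolding complementary_def
  proof (intro conjI ballI allI impI)
    fix e assume e: "e \<in> E" "x' $ e \<noteq> 0"
    show "w e = (\<Sum>v\<in>e. y $ v)"
    proof (cases "e \<in> set (path_edges p)")
      case True
      then show ?thesis using tight_path_edge[OF tight _ dist] by simp
    next
      case False
      then have "x2 $ e \<noteq> 0" using e(2) by (simp add: x'_def x1_def x2_def complement_on_def)
      then have "x $ e \<noteq> 0"
        using half_cycle_val[OF C, of e] half_cycle_val[OF D, of e] other[of e]
        by (cases "e \<in> C"; cases "e \<in> D") auto
      then show ?thesis using comp e(1) by (simp add: complementary_def)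
    qed
  next
    fix u assume "y $ u \<noteq> 0"
    then have "load E x u = 1" using comp by (auto simp: complementary_def)
    then show "load E x' u = 1"
      using flip(3) flip(4)[of u] ld'_last ld_hd x1(3)[of u] x2(3)[of u]
      by (cases "u = hd p"; cases "u = last p") auto
  qed
  then show "basic_max_weight_fm E w x'" by (intro basic_if_complementary[OF simple flip(1) y])
qed

subsection \<open>Alternating walks\<close>

text \<open>The involutions \<open>f\<close> and \<open>g\<close> stand for two matchings and their
  fixed points for exposed vertices. Starting with \<open>g\<close> at a fixed point of
  \<open>f\<close> follows a component of the symmetric difference from one of its ends. A step that
  does not move marks the other end; after it the walk runs back.\<close>

primrec alt_walk :: "('a \<Rightarrow> 'a) \<Rightarrow> ('a \<Rightarrow> 'a) \<Rightarrow> 'a \<Rightarrow> nat \<Rightarrow> 'a" where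
  "alt_walk f g c 0 = c"
| "alt_walk f g c (Suc n) = (if even n then g else f) (alt_walk f g c n)"

context
  fixes f g :: "'a \<Rightarrow> 'a"
  assumes f: "\<And>v. f (f v) = v" and g: "\<And>v. g (g v) = v"
begin

lemma alt_walk_back: "(if even n then g else f) (alt_walk f g c (Suc n)) = alt_walk f g c n"
  using f g by simp

text \<open>Any repetition yields an earlier one. With equal parities both visits were entered by
  the same involution and can be stepped back; with different parities the step out of
  \<open>i\<close> undoes the step into \<open>j\<close>, so the visits move towards each other
  until some step fails to move.\<close>

lemma alt_walk_distinct:
  assumes c: "f c = c" and moves: "\<And>i. i < n \<Longrightarrow> alt_walk f g c (Suc i) \<noteq> alt_walk f g c i"
  shows "i < j \<Longrightarrow> j \<le> n \<Longrightarrow> alt_walk f g c i \<noteq> alt_walk f g c j"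
proof (induction j arbitrary: i rule: less_induct)
  case (less j)
  let ?s = "alt_walk f g c"
  obtain b where b: "j = Suc b" using less.prems(1) by (cases j) auto
  show ?case
  proof
    assume eq: "?s i = ?s j"
    show False
    proof (cases "even i = even j")
      case same: True
      show False
      proof (cases i)
        case 0
        then have "odd b" using same b by simp
        then have "?s b = ?s 0" using alt_walk_back[of b c] eq b c 0 by (metis alt_walk.simps(1))
        moreover have "0 < b" using \<open>odd b\<close> by (rule odd_pos)
        ultimately show False using less.IH[of b 0] less.prems b by simp
      next
        case (Suc a)
        then have "even a = even b" using same b by simp
        then have "?s a = ?s b"
          using alt_walk_back[of a c] alt_walk_back[of b c] eq Suc b by metis
        then show False using less.IH[of b a] less.prems Suc b by simp
      qed
    next
      case False
      then have par: "even i = even b" using b by simp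
      have "?s b = (if even b then g else f) (?s j)" using alt_walk_back[of b c] b by simp
      also have "\<dots> = ?s (Suc i)" using eq par by simp
      finally have retrace: "?s (Suc i) = ?s b" by simp
      show False
      proof (cases "i = b")
        case True
        then show False using moves[of i] eq b less.prems by simp
      next
        case False
        then have "Suc i < b" using less.prems(1) b par by (cases "Suc i = b") auto
        then show False using less.IH[of b "Suc i"] retrace less.prems b by simp
      qed
    qed
  qed
qed

lemma alt_walk_stops:
  assumes "finite (UNIV :: 'a set)" "f c = c"
  shows "\<exists>n. alt_walk f g c (Suc n) = alt_walk f g c n"
proof (rule ccontr)
  assume "\<not> ?thesis"
  then have "alt_walk f g c i \<noteq> alt_walk f g c j" if "i < j" for i j
    using alt_walk_distinct[OF assms(2) _ that order_refl] by blast
  then have "inj (alt_walk f g c)" by (metis injI linorder_neqE_nat)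
  then have "finite (UNIV :: nat set)" using assms(1) by (metis finite_imageD finite_subset subset_UNIV)
  then show False by simp
qed

text \<open>A walk of even length that stops can be retraced from its last vertex, so at most \<open>card T\<close>
  of the walks starting in \<open>S\<close> can end in \<open>T\<close> after an even number of steps.\<close>

lemma alt_walk_escape:
  assumes fin: "finite (UNIV :: 'a set)" and S: "\<And>c. c \<in> S \<Longrightarrow> f c = c" and card: "card T < card S"
  obtains c n where "c \<in> S" "\<And>i. i < n \<Longrightarrow> alt_walk f g c (Suc i) \<noteq> alt_walk f g c i"
    "alt_walk f g c (Suc n) = alt_walk f g c n" "odd n \<or> alt_walk f g c n \<notin> T"
proof (rule ccontr)
  assume no: "\<not> thesis"
  define N where "N c = (LEAST n. alt_walk f g c (Suc n) = alt_walk f g c n)" for c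
  have stop: "alt_walk f g c (Suc (N c)) = alt_walk f g c (N c)" if "c \<in> S" for c
    unfolding N_def using alt_walk_stops[OF fin S[OF that]] by (rule LeastI_ex)
  have moves: "alt_walk f g c (Suc i) \<noteq> alt_walk f g c i" if "i < N c" for c i
    using not_less_Least[OF that[unfolded N_def]] .
  note escape = that
  have bad: "even (N c) \<and> alt_walk f g c (N c) \<in> T" if "c \<in> S" for c
  proof (rule ccontr)
    assume "\<not> (even (N c) \<and> alt_walk f g c (N c) \<in> T)"
    then have "odd (N c) \<or> alt_walk f g c (N c) \<notin> T" by simp
    from no escape[OF \<open>c \<in> S\<close> moves stop[OF \<open>c \<in> S\<close>] this] show False by simp
  qed
  \<comment> \<open>Both walks have even length and so end with the same involution; retracing the
    shorter one shows that its start \<open>c\<close> lies on the walk from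
    \<open>d\<close>.\<close>
  have end_inj: "c = d" if cd: "c \<in> S" "d \<in> S" "alt_walk f g c (N c) = alt_walk f g d (N d)" "N c \<le> N d" for c d
  proof -
    have retrace: "k \<le> N c \<Longrightarrow> alt_walk f g c (N c - k) = alt_walk f g d (N d - k)" for k
    proof (induction k)
      case (Suc k)
      define a b where "a = N c - Suc k" and "b = N d - Suc k"
      have ab: "N c - k = Suc a" "N d - k = Suc b" using Suc.prems cd(4) by (auto simp: a_def b_def)
      have "even a = even b" using bad[OF cd(1)] bad[OF cd(2)] Suc.prems cd(4) by (simp add: a_def b_def)
      then show ?case
        using Suc alt_walk_back[of a c] alt_walk_back[of b d] ab
        unfolding a_def[symmetric] b_def[symmetric] by (metis Suc_leD)
    qed (use cd in simp)
    have eq: "c = alt_walk f g d (N d - N c)" using retrace[of "N c"] by simp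
    show ?thesis
    proof (cases "N d - N c")
      case 0
      then show ?thesis using eq by simp
    next
      case (Suc b)
      \<comment> \<open>If \<open>c\<close> came later on that walk, its even position would mean
        arrival by \<open>f\<close>, which fixes \<open>c\<close>: a step without movement before
        the stop.\<close>
      have "even (N d - N c)" using bad[OF cd(1)] bad[OF cd(2)] cd(4) by simp
      then have "odd b" using Suc by simp
      then have "alt_walk f g d b = f (alt_walk f g d (Suc b))" using f by simp
      then have "alt_walk f g d b = alt_walk f g d (Suc b)" using eq Suc S[OF cd(1)] by metis
      moreover have "b < N d" using Suc by simp
      ultimately show ?thesis using moves[of b d] by simp
    qed
  qed
  have "inj_on (\<lambda>c. alt_walk f g c (N c)) S"
  proof (rule inj_onI)
    fix c d assume cd: "c \<in> S" "d \<in> S" and eq: "alt_walk f g c (N c) = alt_walk f g d (N d)"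
    show "c = d"
      using end_inj[OF cd eq] end_inj[OF cd(2,1) eq[symmetric]] by (cases "N c \<le> N d") simp_all
  qed
  moreover have "(\<lambda>c. alt_walk f g c (N c)) ` S \<subseteq> T" using bad by blast
  moreover have "finite T" using fin by (rule finite_subset[rotated]) simp
  ultimately have "card S \<le> card T" by (rule card_inj_on_le)
  then show False using card by simp
qed

end

text \<open>Presents an integral matching as an involution. The default makes exposed vertices the
  fixed points, as the walk expects.\<close>

definition partner :: "'v::finite set set \<Rightarrow> real^('v set) \<Rightarrow> 'v \<Rightarrow> 'v" where
  "partner E z v = (if \<exists>u. {v, u} \<in> E \<and> z $ {v, u} = 1
                    then SOME u. {v, u} \<in> E \<and> z $ {v, u} = 1 else v)"

lemma partner_edge:
  assumes "partner E z v \<noteq> v"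
  shows "{v, partner E z v} \<in> E" "z $ {v, partner E z v} = 1"
proof -
  have ex: "\<exists>u. {v, u} \<in> E \<and> z $ {v, u} = 1" using assms by (auto simp: partner_def split: if_splits)
  then have "partner E z v = (SOME u. {v, u} \<in> E \<and> z $ {v, u} = 1)" by (simp add: partner_def)
  then show "{v, partner E z v} \<in> E" "z $ {v, partner E z v} = 1" using someI_ex[OF ex] by auto
qed

lemma partner_eq:
  assumes simple: "simple_graph E" and z: "z \<in> fractional_matchings E"
    and u: "{v, u} \<in> E" "z $ {v, u} = 1"
  shows "partner E z v = u"
proof (rule ccontr)
  assume ne: "partner E z v \<noteq> u"
  have ex: "\<exists>u. {v, u} \<in> E \<and> z $ {v, u} = 1" using u by blast
  then have "partner E z v = (SOME u. {v, u} \<in> E \<and> z $ {v, u} = 1)" by (simp add: partner_def)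
  then have p: "{v, partner E z v} \<in> E" "z $ {v, partner E z v} = 1" using someI_ex[OF ex] by auto
  have "{v, u} \<noteq> {v, partner E z v}" using ne by (auto simp: doubleton_eq_iff)
  then have "(\<Sum>e\<in>{{v, u}, {v, partner E z v}}. z $ e) = 2" using u p by simp
  moreover have "(\<Sum>e\<in>{{v, u}, {v, partner E z v}}. z $ e) \<le> load E z v"
    using u p by (intro sum_le_load[OF z]) auto
  moreover have "load E z v \<le> 1" using z by (simp add: fm_iff)
  ultimately show False by linarith
qed

lemma partner_involution:
  assumes "simple_graph E" "z \<in> fractional_matchings E"
  shows "partner E z (partner E z v) = v"
proof (cases "partner E z v = v")
  case False
  then show ?thesis using partner_edge[OF False] assms by (intro partner_eq) (simp_all add: insert_commute)
qed simp

lemma partner_fixed_iff: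
  assumes simple: "simple_graph E" and z: "half_struct E z" "half_cycles E z = {}"
  shows "partner E z v = v \<longleftrightarrow> load E z v = 0"
proof
  have fm: "z \<in> fractional_matchings E" using z by (simp add: half_struct_def)
  assume fixed: "partner E z v = v"
  show "load E z v = 0" unfolding load_def
  proof (rule sum.neutral, rule ballI, rule ccontr)
    fix e assume e: "e \<in> incident E v" "z $ e \<noteq> 0"
    then have "z $ e = 1" using half_struct_cases[OF z(1), of e] z(2) by auto
    moreover obtain a b where "e = {a, b}" "a \<noteq> b"
      using e(1) simple by (auto simp: incident_def simple_graph_def card_2_iff)
    then obtain u where u: "e = {v, u}" "u \<noteq> v"
      using e(1) by (auto simp: incident_def insert_commute)
    ultimately show False using partner_eq[OF simple fm, of v u] e(1) fixed by (simp add: incident_def)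
  qed
next
  have fm: "z \<in> fractional_matchings E" using z by (simp add: half_struct_def)
  assume ld: "load E z v = 0"
  show "partner E z v = v"
  proof (rule ccontr)
    assume "partner E z v \<noteq> v"
    from partner_edge[OF this] show False
      using sum_le_load[OF fm, of "{{v, partner E z v}}" v] ld by simp
  qed
qed

text \<open>Transfers tightness: slackness speaks about the support of \<open>x\<close>, the walk
  uses edges of the rounded matching.\<close>

lemma fully_rounded_support:
  assumes "fully_rounded E x z S" "z $ e \<noteq> 0"
  shows "x $ e \<noteq> 0"
proof (cases "e \<in> \<Union> (half_cycles E x)")
  case True
  then obtain C where "C \<in> half_cycles E x" "e \<in> C" by auto
  from half_cycle_val[OF this] show ?thesis by simp
next
  case False
  then show ?thesis using fully_roundedD(5)[OF assms(1) False] assms(2) by simp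
qed

subsection \<open>Existence of a configuration\<close>

lemma config_exists:
  fixes E :: "'v::finite set set"
  assumes simple: "simple_graph E" and x: "half_struct E x" and z: "half_struct E z"
    and cx: "complementary E w x y" and cz: "complementary E w z y"
    and less: "card (half_cycles E z) < card (half_cycles E x)"
  shows "(\<exists>C v. config_vertex E x y C v) \<or>
         (\<exists>C D p. config_cycle_cycle E w x y C D p) \<or>
         (\<exists>C p. config_cycle_vertex E w x y C p)"
proof -
  let ?HC = "half_cycles E x" and ?M = "unit_edges E x"
  have fmx: "x \<in> fractional_matchings E" using x by (simp add: half_struct_def)
  obtain x1 S where x1: "fully_rounded E x x1 S" using fully_rounded_exists[OF simple x] by blast
  obtain z1 T where z1: "fully_rounded E z z1 T" using fully_rounded_exists[OF simple z] by blast
  note X = fully_roundedD[OF x1] and Z = fully_roundedD[OF z1]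
  have fm1: "x1 \<in> fractional_matchings E" "z1 \<in> fractional_matchings E"
    using X(1) Z(1) by (simp_all add: half_struct_def)
  define f g where "f = partner E x1" and "g = partner E z1"
  have ff: "f (f v) = v" and gg: "g (g v) = v" for v
    unfolding f_def g_def by (rule partner_involution[OF simple fm1(1)] partner_involution[OF simple fm1(2)])+
  have f_fixed: "f v = v \<longleftrightarrow> load E x1 v = 0" and g_fixed: "g v = v \<longleftrightarrow> load E z1 v = 0" for v
    unfolding f_def g_def using partner_fixed_iff[OF simple X(1,2)] partner_fixed_iff[OF simple Z(1,2)] by simp_all
  have "f c = c" if "c \<in> S" for c using f_fixed X(7)[of c] that by simp
  moreover have "card T < card S" using X(4) Z(4) less by simp
  ultimately obtain c n where c: "c \<in> S" "f c = c"
    and moves: "\<And>i. i < n \<Longrightarrow> alt_walk f g c (Suc i) \<noteq> alt_walk f g c i"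
    and stop: "alt_walk f g c (Suc n) = alt_walk f g c n"
    and escape: "odd n \<or> alt_walk f g c n \<notin> T"
    using alt_walk_escape[of f g S T, OF ff gg finite] by metis
  define s where "s = alt_walk f g c"
  define e where "e i = {s i, s (Suc i)}" for i
  have s0: "s 0 = c" by (simp add: s_def)
  have step: "s (Suc i) = (if even i then g (s i) else f (s i))" for i by (simp add: s_def)
  have dist: "s i = s j \<longleftrightarrow> i = j" if "i \<le> n" "j \<le> n" for i j
    using alt_walk_distinct[of f g c n i j, OF ff gg c(2) moves]
      alt_walk_distinct[of f g c n j i, OF ff gg c(2) moves] that
    unfolding s_def by (metis linorder_neqE_nat)
  have moves': "s (Suc i) \<noteq> s i" if "i < n" for i using moves[OF that] by (simp add: s_def)
  have even_edge: "e i \<in> E \<and> z1 $ e i = 1" if "i < n" "even i" for i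
    using partner_edge[of E z1 "s i"] moves'[OF that(1)] step[of i] that by (simp add: e_def g_def)
  have odd_edge: "e i \<in> E \<and> x1 $ e i = 1" if "i < n" "odd i" for i
    using partner_edge[of E x1 "s i"] moves'[OF that(1)] step[of i] that by (simp add: e_def f_def)
  \<comment> \<open>An \<open>x1\<close>-edge here would be the \<open>f\<close>-partner edge of
    \<open>s i\<close>, but \<open>f\<close> leads from \<open>s i\<close> back to its predecessor,
    or fixes it at the start.\<close>
  have even_x1: "x1 $ e i \<noteq> 1" if i: "i < n" "even i" for i
  proof
    assume "x1 $ e i = 1"
    then have eq: "f (s i) = s (Suc i)"
      unfolding f_def using even_edge[OF i] by (intro partner_eq[OF simple fm1(1)]) (simp_all add: e_def)
    show False
    proof (cases i)
      case 0
      then show ?thesis using eq c(2) s0 moves'[OF i(1)] by simp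
    next
      case (Suc a)
      then have "f (s i) = s a" using step[of a] i(2) ff by simp
      then show ?thesis using eq dist[of a "Suc i"] Suc i(1) by simp
    qed
  qed
  have eE: "e i \<in> E" if "i < n" for i using even_edge odd_edge that by blast
  \<comment> \<open>Both optimal solutions are complementary to the same \<open>y\<close>, so the
    edges of both rounded matchings are tight.\<close>
  have tight: "w (e i) = (\<Sum>v\<in>e i. y $ v)" if i: "i < n" for i
  proof (cases "even i")
    case True
    then have "z $ e i \<noteq> 0" using even_edge[OF i True] fully_rounded_support[OF z1, of "e i"] by simp
    then show ?thesis using cz eE[OF i] by (simp add: complementary_def)
  next
    case False
    then have "x $ e i \<noteq> 0" using odd_edge[OF i False] fully_rounded_support[OF x1, of "e i"] by simp
    then show ?thesis using cx eE[OF i] by (simp add: complementary_def)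
  qed
  \<comment> \<open>Off the half cycles \<open>x1\<close> agrees with \<open>x\<close>, so exactly
    the odd-numbered walk edges belong to \<open>?M\<close>. The last edge of the segment has number
    \<open>b - 1\<close>, hence the parity of \<open>b\<close>.\<close>
  have segment: "is_path E p \<and> hd p = s a \<and> last p = s b \<and> tight_path w y p \<and> alternating ?M p \<and>
      path_edges p \<noteq> [] \<and> (last (path_edges p) \<in> ?M \<longleftrightarrow> even b)"
    if ab: "a < b" "b \<le> n" and p: "p = map s [a..<Suc b]"
      and free: "\<And>i. a \<le> i \<Longrightarrow> i < b \<Longrightarrow> e i \<notin> \<Union> ?HC" for a b p
  proof -
    have len: "length p = Suc (b - a)" using ab p by simp
    have nth: "p ! k = s (a + k)" if "k \<le> b - a" for k using that ab p by (simp del: upt_Suc)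
    have pe: "path_edges p ! k = e (a + k)" if "k < b - a" for k
      using that by (simp add: path_edges_nth len nth e_def)
    have lp: "length (path_edges p) = b - a" by (simp add: len)
    have M: "path_edges p ! k \<in> ?M \<longleftrightarrow> odd (a + k)" if "k < b - a" for k
    proof -
      have i: "a + k < n" "e (a + k) \<notin> \<Union> ?HC" using that ab free[of "a + k"] by simp_all
      have "x1 $ e (a + k) = x $ e (a + k)" by (rule X(5)[OF i(2)])
      then show ?thesis
        unfolding pe[OF that] using odd_edge[OF i(1)] even_x1[OF i(1)] eE[OF i(1)]
        by (auto simp: unit_edges_def)
    qed
    have "distinct p"
      unfolding p distinct_map using dist ab by (auto simp: inj_on_def simp del: upt_Suc)
    moreover have "set (path_edges p) \<subseteq> E"
    proof
      fix e' assume "e' \<in> set (path_edges p)"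
      then obtain k where "k < b - a" "e' = path_edges p ! k" by (auto simp: in_set_conv_nth lp simp del: length_path_edges)
      then show "e' \<in> E" using pe eE ab by simp
    qed
    moreover have ne: "p \<noteq> []" using len by auto
    ultimately have path: "is_path E p" by (simp add: is_path_def)
    have ends: "hd p = s a" "last p = s b"
      using nth[of 0] nth[of "b - a"] ab ne by (simp_all add: hd_conv_nth last_conv_nth len)
    have tp: "tight_path w y p"
      unfolding tight_path_def
    proof (intro allI impI)
      fix u v assume "{u, v} \<in> set (path_edges p)"
      then obtain k where k: "k < b - a" "{u, v} = path_edges p ! k"
        by (auto simp: in_set_conv_nth lp simp del: length_path_edges)
      then have i: "a + k < n" "{u, v} = e (a + k)" using ab pe by simp_all
      then have "card {u, v} = 2" using eE[OF i(1)] simple by (simp only: simple_graph_def)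
      then have "u \<noteq> v" by auto
      then show "y $ u + y $ v = w {u, v}" using tight[OF i(1)] unfolding i(2)[symmetric] by simp
    qed
    have "alternating ?M p"
      unfolding alternating_def lp using M by simp
    moreover have pne: "path_edges p \<noteq> []" using lp ab by (auto simp flip: length_greater_0_conv)
    moreover have "last (path_edges p) \<in> ?M \<longleftrightarrow> even b"
      using M[of "b - a - 1"] ab unfolding last_conv_nth[OF pne] lp by simp
    ultimately show ?thesis using path ends tp by simp
  qed
  have on_cycle: "\<exists>C\<in>?HC. s 0 \<in> \<Union> C" using c(1) s0 X(3) by auto
  have disj: "C = D" if "C \<in> ?HC" "D \<in> ?HC" "v \<in> \<Union> C" "v \<in> \<Union> D" for C D v
    using half_cycles_disjoint[OF fmx that] .
  \<comment> \<open>An edge of a half cycle has both ends on it. With inner vertices off all cycles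
    it could only join \<open>s a\<close> directly to \<open>s b\<close>, and these two share no
    cycle.\<close>
  have free: "e i \<notin> \<Union> ?HC"
    if ab: "a \<le> i" "i < b" and inner: "\<And>k. a < k \<Longrightarrow> k < b \<Longrightarrow> s k \<notin> \<Union> (\<Union> ?HC)"
      and ends: "\<And>H. H \<in> ?HC \<Longrightarrow> s a \<in> \<Union> H \<Longrightarrow> s b \<notin> \<Union> H" for a b i
  proof
    assume "e i \<in> \<Union> ?HC"
    then obtain H where H: "H \<in> ?HC" "e i \<in> H" by auto
    then have v: "s i \<in> \<Union> H" "s (Suc i) \<in> \<Union> H" by (auto simp: e_def)
    have on: "s i \<in> \<Union> (\<Union> ?HC)" "s (Suc i) \<in> \<Union> (\<Union> ?HC)" using v H(1) by blast+
    have "\<not> a < i" using inner[OF _ ab(2)] on(1) by blast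
    moreover have "\<not> Suc i < b" using inner[of "Suc i"] on(2) ab(1) by (meson le_imp_less_Suc)
    ultimately have "i = a" "Suc i = b" using ab by auto
    then show False using ends[OF H(1)] v by simp
  qed
  \<comment> \<open>Cut the walk at its last visit to a half cycle. Validity holds at the start
    because half edges saturate that vertex, and at the end because the last edge is in
    \<open>?M\<close> for even \<open>n\<close> and the vertex is exposed for odd
    \<open>n\<close>.\<close>
  have vertex_end: ?thesis if out: "s n \<notin> \<Union> (\<Union> ?HC)" and yn: "y $ s n = 0"
    and valid: "odd n \<Longrightarrow> f (s n) = s n"
  proof -
    define a where "a = Max {i. i \<le> n \<and> s i \<in> \<Union> (\<Union> ?HC)}"
    have fin: "finite {i. i \<le> n \<and> s i \<in> \<Union> (\<Union> ?HC)}" by simp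
    have "0 \<in> {i. i \<le> n \<and> s i \<in> \<Union> (\<Union> ?HC)}" using on_cycle by auto
    then have a: "a \<le> n" "s a \<in> \<Union> (\<Union> ?HC)" using Max_in[OF fin] unfolding a_def by blast+
    have above: "s k \<notin> \<Union> (\<Union> ?HC)" if "a < k" "k \<le> n" for k
    proof
      assume "s k \<in> \<Union> (\<Union> ?HC)"
      then have "k \<in> {i. i \<le> n \<and> s i \<in> \<Union> (\<Union> ?HC)}" using that(2) by blast
      from Max_ge[OF fin this] show False using that(1) unfolding a_def by linarith
    qed
    have an: "a < n" using a out by (cases "a = n") auto
    obtain C where C: "C \<in> ?HC" "s a \<in> \<Union> C" using a(2) by auto
    have no: "e i \<notin> \<Union> ?HC" if "a \<le> i" "i < n" for i
      using that above out by (intro free[of a i n]) auto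
    define p where "p = map s [a..<Suc n]"
    note seg = segment[OF an order_refl p_def no]
    have exposed_cycle: "exposed ?M u" if u: "u \<in> \<Union> C" for u
      unfolding exposed_def
    proof (intro ballI notI)
      fix e' assume e': "e' \<in> ?M" "u \<in> e'"
      then have "e' \<in> C" using half_cycle_edge[OF fmx C(1) u] by (simp add: unit_edges_def)
      then show False using half_cycle_val[OF C(1)] e'(1) by (fastforce simp: unit_edges_def)
    qed
    have "exposed ?M (last p) \<or> path_edges p \<noteq> [] \<and> last (path_edges p) \<in> ?M"
    proof (cases "even n")
      case False
      then have ld: "load E x1 (s n) = 0" using valid f_fixed by simp
      have "exposed ?M (s n)" unfolding exposed_def
      proof (intro ballI notI)
        fix e' assume e': "e' \<in> ?M" "s n \<in> e'"
        then have "e' \<notin> \<Union> ?HC" using out by blast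
        then have "x1 $ e' = 1" using X(5)[of e'] e' by (simp add: unit_edges_def)
        then show False using sum_le_load[OF fm1(1), of "{e'}" "s n"] e' ld by (simp add: unit_edges_def)
      qed
      then show ?thesis using seg by simp
    qed (use seg in simp)
    then have "valid_alt_path ?M p"
      unfolding valid_alt_path_def using seg exposed_cycle[OF C(2)] by simp
    then have "config_cycle_vertex E w x y C p"
      unfolding config_cycle_vertex_def using seg C out yn by simp
    then show ?thesis by blast
  qed
  have uncovered: "y $ v = 0" if "load E q v = 0" "complementary E w q y" for q v
    using that by (auto simp: complementary_def)
  have not_cycle: "v \<notin> \<Union> (\<Union> ?HC)" if "load E x v = 0" for v
    using half_cycle_load[OF fmx] that by fastforce
  show ?thesis
  proof (cases "even n")
    case True
    \<comment> \<open>After an even number of steps \<open>g\<close> is next, so the final vertex is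
      exposed in \<open>z1\<close>. Not being a rounding vertex in \<open>T\<close>, it is exposed
      in \<open>z\<close> too.\<close>
    then have "g (s n) = s n" using stop step[of n] by (simp add: s_def)
    then have "load E z (s n) = 0" using g_fixed Z(7)[of "s n"] escape True by (simp add: s_def)
    then have yn: "y $ s n = 0" using uncovered cz by blast
    show ?thesis
    proof (cases "s n \<in> \<Union> (\<Union> ?HC)")
      case True
      then obtain C where "C \<in> ?HC" "s n \<in> \<Union> C" by auto
      then have "config_vertex E x y C (s n)" using yn by (simp add: config_vertex_def)
      then show ?thesis by blast
    next
      case False
      then show ?thesis using vertex_end yn True by blast
    qed
  next
    case odd: False
    then have fn: "f (s n) = s n" using stop step[of n] by (simp add: s_def)
    show ?thesis
    proof (cases "s n \<in> S")
      case False
      then have ld: "load E x (s n) = 0" using fn f_fixed X(7)[of "s n"] by simp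
      show ?thesis by (rule vertex_end[OF not_cycle[OF ld] uncovered[OF ld cx] fn])
    next
      case True
      obtain C where C: "C \<in> ?HC" "s 0 \<in> \<Union> C" using on_cycle by auto
      obtain D where D: "D \<in> ?HC" "s n \<in> \<Union> D" using True X(3) by auto
      have "s n \<noteq> s 0" using dist[of n 0] odd by (auto simp: odd_pos)
      \<comment> \<open>\<open>S\<close> contains one vertex per half cycle, so distinct rounding
        vertices lie on distinct cycles.\<close>
      then have "D \<noteq> C" using X(6)[OF C(1) True c(1)] C(2) D(2) s0 by auto
      \<comment> \<open>With \<open>b\<close> the first visit to a cycle other than \<open>C\<close>
        and \<open>a\<close> the last visit to \<open>C\<close> before it, nothing strictly between
        them lies on a half cycle.\<close>
      define P where "P i \<longleftrightarrow> (\<exists>D\<in>?HC. D \<noteq> C \<and> s i \<in> \<Union> D)" for i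
      define b where "b = (LEAST i. P i)"
      have "P n" using D \<open>D \<noteq> C\<close> by (auto simp: P_def)
      then have b: "P b" "b \<le> n" unfolding b_def by (rule LeastI, rule Least_le)
      have below: "\<not> P i" if "i < b" for i using that unfolding b_def by (rule not_less_Least)
      obtain B where B: "B \<in> ?HC" "B \<noteq> C" "s b \<in> \<Union> B" using b(1) by (auto simp: P_def)
      have "b \<noteq> 0"
      proof
        assume "b = 0"
        then show False using disj[OF B(1) C(1) B(3)] C(2) B(2) by simp
      qed
      define a where "a = Max {i. i < b \<and> s i \<in> \<Union> C}"
      have fin: "finite {i. i < b \<and> s i \<in> \<Union> C}" by simp
      have "0 \<in> {i. i < b \<and> s i \<in> \<Union> C}" using C(2) \<open>b \<noteq> 0\<close> by simp
      then have a: "a < b" "s a \<in> \<Union> C" using Max_in[OF fin] unfolding a_def by blast+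
      have inner: "s k \<notin> \<Union> (\<Union> ?HC)" if k: "a < k" "k < b" for k
      proof
        assume "s k \<in> \<Union> (\<Union> ?HC)"
        then obtain H where H: "H \<in> ?HC" "s k \<in> \<Union> H" by auto
        then have "H = C" using below[OF k(2)] by (auto simp: P_def)
        then have "k \<in> {i. i < b \<and> s i \<in> \<Union> C}" using k H by simp
        from Max_ge[OF fin this] show False using k(1) by (simp add: a_def)
      qed
      have ends: "s b \<notin> \<Union> H" if "H \<in> ?HC" "s a \<in> \<Union> H" for H
        using disj[OF that(1) C(1) that(2) a(2)] disj[OF B(1) C(1) B(3)] B(2) by blast
      define p where "p = map s [a..<Suc b]"
      have no: "e i \<notin> \<Union> ?HC" if "a \<le> i" "i < b" for i
        by (rule free[OF that inner ends])
      have "config_cycle_cycle E w x y C B p"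
        unfolding config_cycle_cycle_def
        using segment[OF a(1) b(2) p_def no] C(1) B a(2) by simp
      then show ?thesis by blast
    qed
  qed
qed

theorem theorem5:
  fixes E :: "'v::finite set set"
    and w :: "'v set \<Rightarrow> real"
    and x :: "real^('v set)"
    and y :: "real^'v"
  assumes "simple_graph E"
    and "\<forall>e\<in>E. 0 \<le> w e"
    and "basic_max_weight_fm E w x"
    and "min_fractional_cover E w y"
    and "card (half_cycles E x) > gamma E w"
  shows "((\<exists>C v. config_vertex E x y C v) \<or>
          (\<exists>C D p. config_cycle_cycle E w x y C D p) \<or>
          (\<exists>C p. config_cycle_vertex E w x y C p)) \<and>
         (\<forall>C v. config_vertex E x y C v \<longrightarrow>
            (let x' = alternate_round C v x in
             basic_max_weight_fm E w x' \<and> half_cycles E x' \<subset> half_cycles E x)) \<and>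
         (\<forall>C D p. config_cycle_cycle E w x y C D p \<longrightarrow>
            (let x' = complement_on (set (path_edges p))
                        (alternate_round D (last p) (alternate_round C (hd p) x)) in
             basic_max_weight_fm E w x' \<and> half_cycles E x' \<subset> half_cycles E x)) \<and>
         (\<forall>C p. config_cycle_vertex E w x y C p \<longrightarrow>
            (let x' = complement_on (set (path_edges p)) (alternate_round C (hd p) x) in
             basic_max_weight_fm E w x' \<and> half_cycles E x' \<subset> half_cycles E x))"
proof -
  have basic: "half_struct E q \<and> complementary E w q y" if "basic_max_weight_fm E w q" for q
    using that half_struct_if_extreme[OF assms(1)] complementary_if_max_weight[OF assms(1) _ assms(4)]
    by (simp add: basic_max_weight_fm_def)
  have x: "half_struct E x" "complementary E w x y" using basic[OF assms(3)] by simp_all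
  have y: "y \<in> fractional_covers E w" using assms(4) by (simp add: min_fractional_cover_def)
  \<comment> \<open>The cycle counts are bounded, so this set of naturals is finite even without
    knowing that there are finitely many basic solutions, and the minimum is attained by some
    \<open>z\<close>.\<close>
  let ?G = "{card (half_cycles E q) | q. basic_max_weight_fm E w q}"
  have "?G \<subseteq> {..card (UNIV :: 'v set set set)}"   proof
    fix k assume "k \<in> ?G"
    then obtain q where "k = card (half_cycles E q)" by blast
    also have "\<dots> \<le> card (UNIV :: 'v set set set)" by (rule card_mono) simp_all
    finally show "k \<in> {..card (UNIV :: 'v set set set)}" by (simp only: atMost_iff)
  qed
  then have "finite ?G" by (rule finite_subset) simp
  moreover have "?G \<noteq> {}" using assms(3) by blast
  ultimately have "gamma E w \<in> ?G" unfolding gamma_def by (rule Min_in)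
  then obtain z where z: "basic_max_weight_fm E w z" "gamma E w = card (half_cycles E z)" by blast
  have less: "card (half_cycles E z) < card (half_cycles E x)" using assms(5) z(2) by simp
  have zs: "half_struct E z" "complementary E w z y" using basic[OF z(1)] by simp_all
  show ?thesis
    unfolding Let_def
    using config_exists[OF assms(1) x(1) zs(1) x(2) zs(2) less]
      config_vertex_improves[OF assms(1) x(1) y x(2)]
      config_cycle_cycle_improves[OF assms(1) x(1) y x(2)]
      config_cycle_vertex_improves[OF assms(1) x(1) y x(2)]
    by (intro conjI allI impI) simp_all
qed

end
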